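(* Let $f\in\mathcal{S}(L,m)$ with unique minimizer $x^\star$. Suppose: (A1) $f$ is twice differentiable and its Hessian is locally Hölder-smooth at $x^\star$: there exist $\delta_H>0$, $L_H>0$, $\alpha_H>0$ such that $\Vert x-x^\star\Vert\le\delta_H$ implies $\Vert\nabla^2f(x)-\nabla^2f(x^\star)\Vert\le L_H\Vert x-x^\star\Vert^{\alpha_H}$; (A2) a number $L_0>L$ is known and used as input of the NAG-free algorithm (described in the context); (A3) there exists $\delta_\lambda\in(0,1)$ such that the estimates $m_t$ produced by NAG-free satisfy $|m_t-\lambda_i|>\delta_\lambda L$ for every $t$ and every eigenvalue $\lambda_i$ of $\nabla^2f(x^\star)$ with $\lambda_i>m$; (A4) there exists $\omega>0$ such that $\omega\,x_{0,1}^2\ge\Vert x_0-x^\star\Vert^2$, where $x_{0,1}$ is the $m$-coordinate of $x_0-x^\star$ (see context). Suppose moreover that $\bar\kappa=L_0/m>L/m\ge4$. Then there is $\epsilon>0$ such that if $\Vert x_0-x^\star\Vert\le\epsilon$, then the iterates $x_t$ produced by NAG-free satisfy, for all $t\ge 0$, $$\Vert x_{t+1}-x^\star\Vert\le C\Bigl(1-\frac1{\sqrt{\sigma\bar\kappa}}\Bigr)^{t}\Vert x_0-x^\star\Vert,$$ where $\sigma$ is a constant that depends on $\gamma$ and $C$ is a constant that depends on $\bar\kappa$ and $\omega$.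
   Context: $\Vert\cdot\Vert$ is the Euclidean norm (spectral norm for matrices). A differentiable $f:\mathbb{R}^d\to\mathbb{R}$ belongs to $\mathcal{S}(L,m)$, with $L>0$ and $m>0$, if for all $x,y\in\mathbb{R}^d$ $$f(x)+\langle\nabla f(x),y-x\rangle+\tfrac m2\Vert y-x\Vert^2\le f(y)\le f(x)+\langle\nabla f(x),y-x\rangle+\tfrac L2\Vert y-x\Vert^2 .$$ Coordinates: let $v_1,\dots,v_d$ be an orthonormal basis of eigenvectors of the symmetric matrix $\nabla^2f(x^\star)$ with eigenvalues $\lambda_1\le\dots\le\lambda_d$; by the paper's convention $m=\lambda_1$ and $\lambda_d=L$. Write $x_t-x^\star=\sum_{i=1}^dx_{t,i}v_i$; $x_{t,i}$ is the $\lambda_i$-coordinate of $x_t-x^\star$, so $x_{0,1}$ is the $m$-coordinate of $x_0-x^\star$. NAG-free algorithm. Inputs: $x_0=y_0\in\mathbb{R}^d$, $L_0>0$, $\gamma>1$, $\gamma_L>1$. Set $m_0=L_0$. For $t=0,1,2,\dots$: (1) Backtracking: starting from the current value $L_t$, set $y_{t+1}=x_t-(1/L_t)\nabla f(x_t)$; while $f(y_{t+1})>f(x_t)-\frac1{2L_t}\Vert\nabla f(x_t)\Vert^2$, replace $L_t$ by $\gamma_LL_t$ and recompute $y_{t+1}=x_t-(1/L_t)\nabla f(x_t)$. Let $\hat L_t$ be the final value of $L_t$ in this iteration and set $L_{t+1}=\hat L_t$. (2) Set $x_{t+1}=y_{t+1}+\dfrac{\sqrt{\hat L_t}-\sqrt{m_t}}{\sqrt{\hat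 L_t}+\sqrt{m_t}}(y_{t+1}-y_t)$. (3) Set $c_{t+1}=\Vert\nabla f(x_{t+1})-\nabla f(x_t)\Vert/\Vert x_{t+1}-x_t\Vert$ (defined for $x_{t+1}\ne x_t$). (4) If $c_{t+1}<m_t$, set $m_{t+1}=\min(m_t/\gamma,c_{t+1})$; otherwise set $m_{t+1}=m_t$. The iterates are considered as long as they are well defined, i.e. $x_{t+1}\ne x_t$ whenever $c_{t+1}$ is computed. *)

theory Defs
  imports "HOL-Analysis.Analysis" "HOL-Library.While_Combinator"
begin

text \<open>
  Euclidean space of dimension \<open>d\<close> is represented by a \<open>d\<close>-dimensional subspace \<open>E\<close> of a real inner
  product space (for \<open>'a :: euclidean_space\<close> one may take \<open>E = UNIV\<close>). The reason is that a
  dimension carried by a type cannot be quantified inside a formula, whereas the constants of the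
  convergence theorem have to be chosen before, and hence independently of, the dimension. As \<open>'a\<close> is
  arbitrary, in particular possibly infinite-dimensional, one such \<open>'a\<close> contains a copy
  of every Euclidean space. All functions are only used on \<open>E\<close>, and all
  derivatives are taken within \<open>E\<close>.
\<close>

definition grad_on :: "'a::real_inner set \<Rightarrow> ('a \<Rightarrow> real) \<Rightarrow> 'a \<Rightarrow> 'a" where
  "grad_on E f x = (THE g. g \<in> E \<and> (f has_derivative (\<lambda>h. g \<bullet> h)) (at x within E))"

text \<open>The Hessian as a linear operator; its values are determined on vectors of \<open>E\<close> only.\<close>

definition hess_on :: "'a::real_inner set \<Rightarrow> ('a \<Rightarrow> real) \<Rightarrow> 'a \<Rightarrow> 'a \<Rightarrow> 'a" where
  "hess_on E f x = frechet_derivative (grad_on E f) (at x within E)"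

definition twice_differentiable_on :: "('a::real_inner \<Rightarrow> real) \<Rightarrow> 'a set \<Rightarrow> bool" where
  "twice_differentiable_on f E \<longleftrightarrow> f differentiable_on E \<and> grad_on E f differentiable_on E"

text \<open>Spectral norm of an operator on \<open>E\<close>: \<^const>\<open>onorm\<close> with the supremum restricted to \<open>E\<close>.\<close>

definition onorm_on :: "'a::real_normed_vector set \<Rightarrow> ('a \<Rightarrow> 'a) \<Rightarrow> real" where
  "onorm_on E A = (SUP h\<in>E. norm (A h) / norm h)"

definition smooth_strongly_convex :: "'a::real_inner set \<Rightarrow> real \<Rightarrow> real \<Rightarrow> ('a \<Rightarrow> real) \<Rightarrow> bool" where
  "smooth_strongly_convex E L m f \<longleftrightarrow>
     L > 0 \<and> m > 0 \<and> f differentiable_on E \<and>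
     (\<forall>x\<in>E. \<forall>y\<in>E.
        f x + grad_on E f x \<bullet> (y - x) + m / 2 * (norm (y - x))\<^sup>2 \<le> f y \<and>
        f y \<le> f x + grad_on E f x \<bullet> (y - x) + L / 2 * (norm (y - x))\<^sup>2)"

definition unique_minimizer :: "'a set \<Rightarrow> ('a \<Rightarrow> real) \<Rightarrow> 'a \<Rightarrow> bool" where
  "unique_minimizer E f xs \<longleftrightarrow> (\<forall>x. is_arg_min f (\<lambda>z. z \<in> E) x \<longleftrightarrow> x = xs)"

definition hessian_locally_hoelder :: "'a::real_inner set \<Rightarrow> ('a \<Rightarrow> real) \<Rightarrow> 'a \<Rightarrow> bool" where
  "hessian_locally_hoelder E f xs \<longleftrightarrow>
     (\<exists>\<delta>H>0. \<exists>LH>0. \<exists>\<alpha>H>0. \<forall>x\<in>E. norm (x - xs) \<le> \<delta>H \<longrightarrow>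
        onorm_on E (\<lambda>h. hess_on E f x h - hess_on E f xs h) \<le> LH * norm (x - xs) powr \<alpha>H)"

definition orthonormal_eigenbasis ::
  "'a::real_inner set \<Rightarrow> ('a \<Rightarrow> 'a) \<Rightarrow> nat \<Rightarrow> (nat \<Rightarrow> 'a) \<Rightarrow> (nat \<Rightarrow> real) \<Rightarrow> bool" where
  "orthonormal_eigenbasis E A d v lam \<longleftrightarrow>
     (\<forall>i\<in>{1..d}. \<forall>j\<in>{1..d}. v i \<bullet> v j = (if i = j then 1 else 0)) \<and>
     span (v ` {1..d}) = E \<and>
     (\<forall>i\<in>{1..d}. A (v i) = lam i *\<^sub>R v i) \<and>
     mono_on {1..d} lam"

definition nag_backtrack ::
  "'a::real_inner set \<Rightarrow> ('a \<Rightarrow> real) \<Rightarrow> real \<Rightarrow> 'a \<Rightarrow> real \<Rightarrow> real" where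
  "nag_backtrack E f \<gamma>L x L =
     while (\<lambda>l. f (x - (1 / l) *\<^sub>R grad_on E f x) > f x - 1 / (2 * l) * (norm (grad_on E f x))\<^sup>2)
           (\<lambda>l. \<gamma>L * l) L"

text \<open>
  The state after \<open>t\<close> iterations consists of \<open>x\<^sub>t\<close>, \<open>y\<^sub>t\<close>, the value of \<open>L\<^sub>t\<close> with which the
  backtracking of iteration \<open>t\<close> starts, and \<open>m\<^sub>t\<close>. The state after \<open>t\<close> iterations is meaningful
  only if \<open>nag_defined\<close> holds at \<open>t\<close>; otherwise some quotient \<open>c\<close> has been
  computed with denominator zero.
\<close>

primrec nag_free ::
  "'a::real_inner set \<Rightarrow> ('a \<Rightarrow> real) \<Rightarrow> real \<Rightarrow> real \<Rightarrow> real \<Rightarrow> 'a \<Rightarrow> nat \<Rightarrow> 'a \<times> 'a \<times> real \<times> real" where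
  "nag_free E f L0 \<gamma> \<gamma>L x0 0 = (x0, x0, L0, L0)"
| "nag_free E f L0 \<gamma> \<gamma>L x0 (Suc t) =
     (let (x, y, L, m) = nag_free E f L0 \<gamma> \<gamma>L x0 t;
          Lh = nag_backtrack E f \<gamma>L x L;
          y' = x - (1 / Lh) *\<^sub>R grad_on E f x;
          x' = y' + ((sqrt Lh - sqrt m) / (sqrt Lh + sqrt m)) *\<^sub>R (y' - y);
          c = norm (grad_on E f x' - grad_on E f x) / norm (x' - x);
          m' = (if c < m then min (m / \<gamma>) c else m)
      in (x', y', Lh, m'))"

definition nag_x ::
  "'a::real_inner set \<Rightarrow> ('a \<Rightarrow> real) \<Rightarrow> real \<Rightarrow> real \<Rightarrow> real \<Rightarrow> 'a \<Rightarrow> nat \<Rightarrow> 'a" where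
  "nag_x E f L0 \<gamma> \<gamma>L x0 t = (case nag_free E f L0 \<gamma> \<gamma>L x0 t of (x, y, L, m) \<Rightarrow> x)"

definition nag_m ::
  "'a::real_inner set \<Rightarrow> ('a \<Rightarrow> real) \<Rightarrow> real \<Rightarrow> real \<Rightarrow> real \<Rightarrow> 'a \<Rightarrow> nat \<Rightarrow> real" where
  "nag_m E f L0 \<gamma> \<gamma>L x0 t = (case nag_free E f L0 \<gamma> \<gamma>L x0 t of (x, y, L, m) \<Rightarrow> m)"

text \<open>
  All of \<open>c\<^sub>1, \<dots>, c\<^sub>t\<close> are defined. Then \<open>m\<^sub>t\<close> is defined, and so is \<open>x\<close> at index \<open>t + 1\<close>,
  which is computed before the next \<open>c\<close>.
\<close>

definition nag_defined ::
  "'a::real_inner set \<Rightarrow> ('a \<Rightarrow> real) \<Rightarrow> real \<Rightarrow> real \<Rightarrow> real \<Rightarrow> 'a \<Rightarrow> nat \<Rightarrow> bool" where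
  "nag_defined E f L0 \<gamma> \<gamma>L x0 t \<longleftrightarrow>
     (\<forall>s<t. nag_x E f L0 \<gamma> \<gamma>L x0 (Suc s) \<noteq> nag_x E f L0 \<gamma> \<gamma>L x0 s)"

end

theory Submission
  imports Defs
begin

text \<open>
  Since \<open>L\<^sub>0 > L\<close>, backtracking never changes \<open>L\<^sub>0\<close>; moreover \<open>m\<^bsub>t+1\<^esub> \<le> c\<^bsub>t+1\<^esub>\<close> always, and \<open>m\<^sub>t \<ge> m / \<gamma>\<close> by strong
  convexity. In the eigenbasis of the Hessian at \<open>x\<^sup>\<star>\<close> the iteration is a family of damped oscillators with
  stiffness \<open>q\<^sub>i = \<lambda>\<^sub>i / L\<^sub>0\<close> and nonincreasing damping parameter \<open>\<theta>\<^sub>t = sqrt (m\<^sub>t / L\<^sub>0)\<close>, up to a perturbation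
  that is arbitrarily small relative to \<open>\<parallel>x\<^sub>t - x\<^sup>\<star>\<parallel>\<close> near \<open>x\<^sup>\<star>\<close>.

  An energy that decreases for every momentum coefficient in \<open>[0, 1]\<close> keeps the iterates near \<open>x\<^sup>\<star>\<close>. While
  \<open>m\<^sub>t > 144 m\<close>, the mode of the eigenvalue \<open>m\<close> is overdamped and decays more slowly than all modes with
  \<open>\<lambda>\<^sub>i > 120 m\<close>. Hence after a number of steps depending only on \<open>\<kappa>\<close> and \<open>\<omega>\<close> the quotient \<open>c\<^sub>t\<close>, and with it
  \<open>m\<^sub>t\<close>, is at most \<open>144 m\<close>; these steps only enter the constant. From then on
  \<open>m / \<gamma> \<le> m\<^sub>t \<le> 144 m\<close>, and one Lyapunov function, monotone in \<open>\<theta>\<close>, contracts all modes at the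
  accelerated rate. For \<open>\<kappa> \<le> 1296\<close> the energy alone already gives that rate.
\<close>

section \<open>Lyapunov functions of a single mode\<close>

text \<open>With \<open>\<theta>\<close> the square root of m_t / L_0 this is the momentum
  coefficient of the algorithm, numerator and denominator divided by \<open>sqrt L0\<close>.\<close>

definition mom :: "real \<Rightarrow> real" where
  "mom \<theta> = (1 - \<theta>) / (1 + \<theta>)"

text \<open>The weight \<open>1 - q\<close> on \<open>d\<^sup>2\<close> would cancel the mixed term
  of one step but vanishes at \<open>q = 1\<close>. The weight \<open>1 - q / 2\<close> stays at
  least 1/2 and leaves a mixed term with coefficient of order \<open>q\<^sup>2\<close>.\<close>

definition energy :: "real \<Rightarrow> real \<Rightarrow> real \<Rightarrow> real" where
  "energy q y d = (1 - q / 2) * d\<^sup>2 + q * y\<^sup>2"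

text \<open>
  The discrete analogue of \<open>\<xi>'\<^sup>2 + q \<xi>\<^sup>2 + 2 c \<xi> \<xi>' + 2 c \<theta> \<xi>\<^sup>2\<close> for the oscillator
  \<open>\<xi>'' + 2 \<theta> \<xi>' + q \<xi> = 0\<close>. The factor \<open>(1 - b) / b\<close>, \<open>b = (1 - q) * mom \<theta>\<close>, makes the mixed
  term telescope; since it increases with \<open>\<theta>\<close>, a decrease of \<open>\<theta>\<close> costs nothing.
\<close>

definition damped_energy :: "real \<Rightarrow> real \<Rightarrow> real \<Rightarrow> real \<Rightarrow> real \<Rightarrow> real" where
  "damped_energy c q \<theta> y d = (1 - q) * d\<^sup>2 + q * y\<^sup>2 +
     c * (2 * y * d + (1 - (1 - q) * mom \<theta>) / ((1 - q) * mom \<theta>) * y\<^sup>2)"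

lemma mom_bounds:
  assumes "0 \<le> \<theta>" "\<theta> \<le> 1"
  shows "0 \<le> mom \<theta>" "mom \<theta> \<le> 1"
  using assms by (auto simp: mom_def field_simps)

lemma mom_antimono:
  assumes "0 \<le> \<theta>'" "\<theta>' \<le> \<theta>"
  shows "mom \<theta> \<le> mom \<theta>'"
  using assms by (auto simp: mom_def field_simps)

lemma mom_ge_half:
  assumes "0 \<le> \<theta>" "\<theta> \<le> 1 / 3"
  shows "1 / 2 \<le> mom \<theta>"
  using assms by (auto simp: mom_def field_simps)

lemma energy_nonneg: "0 \<le> q \<Longrightarrow> q \<le> 1 \<Longrightarrow> 0 \<le> energy q y d"
  by (simp add: energy_def)

text \<open>The gradient step alone supplies the contraction, so any momentum coefficient in [0, 1]
  is admissible; the price is the unaccelerated rate \<open>q / 2\<close>.\<close>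

lemma energy_step:
  assumes q: "0 \<le> q" "q \<le> 1" and \<beta>: "0 \<le> \<beta>" "\<beta> \<le> 1"
  shows "energy q ((1 - q) * (y + \<beta> * d)) ((1 - q) * (y + \<beta> * d) - y) \<le> (1 - q / 2) * energy q y d"
proof -
  define b where "b = (1 - q) * \<beta>"
  have b: "0 \<le> b" "b \<le> 1 - q"
    using q \<beta> mult_left_mono[of \<beta> 1 "1 - q"] by (auto simp: b_def)
  have eq: "energy q ((1 - q) * (y + \<beta> * d)) ((1 - q) * (y + \<beta> * d) - y)
      = q * (1 - q + q\<^sup>2 / 2) * y\<^sup>2 + b\<^sup>2 * (1 + q / 2) * d\<^sup>2 - q\<^sup>2 * b * (y * d)"
    unfolding energy_def b_def by (simp add: field_simps power2_eq_square)
  have "- (y * d) \<le> (y\<^sup>2 + d\<^sup>2) / 2"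
    using zero_le_power2[of "y + d"] by (simp add: power2_sum)
  hence "q\<^sup>2 * b * (- (y * d)) \<le> q\<^sup>2 * b * ((y\<^sup>2 + d\<^sup>2) / 2)"
    using b by (intro mult_left_mono) auto
  also have "\<dots> \<le> q\<^sup>2 * (1 - q) * ((y\<^sup>2 + d\<^sup>2) / 2)"
    using b by (intro mult_right_mono mult_left_mono) auto
  finally have 1: "- q\<^sup>2 * b * (y * d) \<le> q\<^sup>2 * (1 - q) * ((y\<^sup>2 + d\<^sup>2) / 2)" by simp
  have "b\<^sup>2 \<le> (1 - q)\<^sup>2" using b by (intro power_mono) auto
  hence 2: "b\<^sup>2 * (1 + q / 2) * d\<^sup>2 \<le> (1 - q)\<^sup>2 * (1 + q / 2) * d\<^sup>2"
    using q by (intro mult_right_mono) auto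
  have "energy q ((1 - q) * (y + \<beta> * d)) ((1 - q) * (y + \<beta> * d) - y)
     \<le> q * (1 - q + q\<^sup>2 / 2) * y\<^sup>2 + (1 - q)\<^sup>2 * (1 + q / 2) * d\<^sup>2 + q\<^sup>2 * (1 - q) * ((y\<^sup>2 + d\<^sup>2) / 2)"
    unfolding eq using 1 2 by simp
  \<comment> \<open>The even split of the mixed term makes \<open>1 - q / 2\<close> an exact common
    factor of both coefficients.\<close>
  also have "\<dots> = q * (1 - q / 2) * y\<^sup>2 + (1 - q) * (1 - q / 2) * d\<^sup>2"
    by (simp add: field_simps power2_eq_square)
  also have "\<dots> \<le> q * (1 - q / 2) * y\<^sup>2 + (1 - q / 2) * (1 - q / 2) * d\<^sup>2"
    using q by (intro add_left_mono mult_right_mono) auto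
  also have "\<dots> = (1 - q / 2) * energy q y d"
    by (simp add: energy_def field_simps)
  finally show ?thesis .
qed

text \<open>Every nonnegative quadratic form \<open>Q\<close> satisfies \<open>Q (s + w) \<le> (1 + \<nu>) Q s + (1 + 1/\<nu>) Q w\<close>, the
  difference of both sides being \<open>\<nu> Q (s - w / \<nu>)\<close>.\<close>
lemma quadratic_form_perturb:
  fixes Q :: "real \<Rightarrow> real \<Rightarrow> real"
  assumes Q: "\<And>y d. Q y d = A * y\<^sup>2 + B * (y * d) + C * d\<^sup>2"
    and nn: "\<And>y d. 0 \<le> Q y d" and \<nu>: "0 < \<nu>"
  shows "Q (y + r) (d + s) \<le> (1 + \<nu>) * Q y d + (1 + 1 / \<nu>) * Q r s"
proof -
  have "(1 + \<nu>) * Q y d + (1 + 1 / \<nu>) * Q r s - Q (y + r) (d + s) = \<nu> * Q (y - r / \<nu>) (d - s / \<nu>)"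
    unfolding Q using \<nu> by (simp add: field_simps power2_eq_square)
  thus ?thesis using nn[of "y - r / \<nu>" "d - s / \<nu>"] \<nu> by (smt (verit) mult_nonneg_nonneg)
qed

section \<open>The damped energy of one mode with small damping and small stiffness\<close>

context
  fixes c q \<theta> :: real
  assumes c: "0 < c" "c \<le> \<theta> / 4" and \<theta>: "\<theta> \<le> 1 / 3" and q: "0 < q" "q \<le> 1 / 8"
begin

private abbreviation "b \<equiv> (1 - q) * mom \<theta>"

text \<open>From \<open>1 - mom \<theta> = 2 * \<theta> / (1 + \<theta>)\<close>: the friction
  \<open>1 - b\<close> is of order \<open>\<theta>\<close> from below and of order
  \<open>q + \<theta>\<close> from above, while \<open>b\<close> stays away from 0.\<close>

private lemma b_bounds: "7 / 16 \<le> b" "b \<le> 1 - q" "1 - b \<le> q + 2 * \<theta>" "3 / 2 * \<theta> \<le> 1 - b"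
proof -
  have t: "0 < \<theta>" using c by simp
  have m: "1 / 2 \<le> mom \<theta>" "mom \<theta> \<le> 1" using mom_ge_half mom_bounds t \<theta> by auto
  show "7 / 16 \<le> b" using mult_mono[of "7/8" "1 - q" "1/2" "mom \<theta>"] m q by simp
  show "b \<le> 1 - q" using m q mult_left_mono[of "mom \<theta>" 1 "1 - q"] by simp
  have 1: "1 - mom \<theta> = 2 * \<theta> / (1 + \<theta>)" using t by (simp add: mom_def field_simps)
  also have "\<dots> \<le> 2 * \<theta>" using t by (simp add: field_simps)
  finally have "1 - mom \<theta> \<le> 2 * \<theta>" .
  moreover have "q * mom \<theta> \<le> q" using m q by simp
  ultimately show "1 - b \<le> q + 2 * \<theta>" by (simp add: algebra_simps)
  have "3 / 2 * \<theta> \<le> 2 * \<theta> / (1 + \<theta>)"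
  proof -
    have "\<theta> * \<theta> \<le> 1 / 3 * \<theta>" using \<theta> t by (intro mult_right_mono) auto
    thus ?thesis using t by (simp add: field_simps)
  qed
  also have "\<dots> = 1 - mom \<theta>" using 1 by simp
  also have "\<dots> \<le> 1 - b" using m q by (simp add: algebra_simps)
  finally show "3 / 2 * \<theta> \<le> 1 - b" .
qed

text \<open>The mixed term is split by Young's inequality. The share 7/16 of
  \<open>d\<^sup>2\<close> is \<open>(1 - q) / 2\<close> at \<open>q = 1 / 8\<close>; the rest is
  paid by the weight \<open>(1 - b) / b\<close> of \<open>y\<^sup>2\<close>, which is at least
  \<open>4 * c\<close>.\<close>

private lemma damped_energy_lower_aux: "(1 - q) / 2 * d\<^sup>2 + q * y\<^sup>2 \<le> damped_energy c q \<theta> y d"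
proof -
  have t: "0 < \<theta>" using c by simp
  have "0 \<le> (d / 2 + 2 * c * y)\<^sup>2 + 3 / 16 * d\<^sup>2" by simp
  hence "- (2 * c * y * d) \<le> 7 / 16 * d\<^sup>2 + 4 * c\<^sup>2 * y\<^sup>2"
    by (simp add: power2_eq_square field_simps)
  moreover have "7 / 16 * d\<^sup>2 \<le> (1 - q) / 2 * d\<^sup>2" using q by (intro mult_right_mono) auto
  moreover have "4 * c\<^sup>2 * y\<^sup>2 \<le> c * ((1 - b) / b) * y\<^sup>2"
  proof -
    have "4 * c \<le> \<theta>" using c by simp
    also have "\<dots> \<le> 1 - b" using b_bounds t by simp
    also have "\<dots> \<le> (1 - b) / b"
    proof -
      have "(1 - b) * b \<le> (1 - b) * 1" using b_bounds q t by (intro mult_left_mono) auto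
      thus ?thesis using b_bounds by (simp add: pos_le_divide_eq)
    qed
    finally have "c * (4 * c) \<le> c * ((1 - b) / b)" using c by (intro mult_left_mono) auto
    thus ?thesis by (intro mult_right_mono) (auto simp: power2_eq_square)
  qed
  ultimately have "(1 - q) / 2 * d\<^sup>2 + q * y\<^sup>2
      \<le> (1 - q) / 2 * d\<^sup>2 + (1 - q) / 2 * d\<^sup>2 + q * y\<^sup>2 + 2 * c * y * d + c * ((1 - b) / b) * y\<^sup>2"
    by linarith
  also have "\<dots> = damped_energy c q \<theta> y d" unfolding damped_energy_def
    by (simp only: distrib_left mult.assoc mult.left_commute[of 2])
  finally show ?thesis .
qed

lemma damped_energy_lower: "energy q y d / 3 \<le> damped_energy c q \<theta> y d"
proof -
  have "energy q y d / 3 = (1 - q / 2) / 3 * d\<^sup>2 + q / 3 * y\<^sup>2" by (simp add: energy_def field_simps)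
  also have "\<dots> \<le> (1 - q) / 2 * d\<^sup>2 + q * y\<^sup>2"
    using q by (intro add_mono mult_right_mono) auto
  finally show ?thesis using damped_energy_lower_aux[of d y] by linarith
qed

text \<open>The coefficient of \<open>y\<^sup>2\<close> is resolved into \<open>q\<close> and
  \<open>c * \<theta>\<close> because a step dissipates only order \<open>c * q\<close> of
  \<open>y\<^sup>2\<close>: a rate \<open>\<tau>\<close> then needs \<open>\<tau>\<close> at most of
  order \<open>c\<close> and \<open>\<tau> * \<theta>\<close> at most of order
  \<open>q\<close>.\<close>

private lemma damped_energy_upper_aux: "damped_energy c q \<theta> y d \<le> 5 / 4 * d\<^sup>2 + (13 / 10 * q + 6 * c * \<theta>) * y\<^sup>2"
proof -
  have t: "0 < \<theta>" using c by simp
  have "2 * y * d \<le> \<theta> * y\<^sup>2 + d\<^sup>2 / \<theta>"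
  proof -
    have "0 \<le> \<theta> * (y - d / \<theta>)\<^sup>2" using t by simp
    also have "\<theta> * (y - d / \<theta>)\<^sup>2 = \<theta> * y\<^sup>2 + d\<^sup>2 / \<theta> - 2 * y * d"
      using t by (simp add: power2_eq_square field_simps)
    finally show ?thesis by simp
  qed
  hence "c * (2 * y * d) \<le> c * (\<theta> * y\<^sup>2 + d\<^sup>2 / \<theta>)" using c by (intro mult_left_mono) auto
  also have "\<dots> = c * \<theta> * y\<^sup>2 + (c / \<theta>) * d\<^sup>2" by (simp add: algebra_simps)
  also have "\<dots> \<le> c * \<theta> * y\<^sup>2 + 1 / 4 * d\<^sup>2"
    using c t by (intro add_left_mono mult_right_mono) (auto simp: field_simps)
  finally have 1: "c * (2 * y * d) \<le> c * \<theta> * y\<^sup>2 + 1 / 4 * d\<^sup>2" .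
  have "(1 - b) / b \<le> (q + 2 * \<theta>) / (7 / 16)"
    using b_bounds q t by (intro frac_le) auto
  hence "c * ((1 - b) / b) \<le> c * ((q + 2 * \<theta>) / (7 / 16))" using c by (intro mult_left_mono) auto
  also have "\<dots> = 16 / 7 * (c * q) + 32 / 7 * (c * \<theta>)" by (simp add: algebra_simps)
  also have "\<dots> \<le> 16 / 7 * (1 / 12 * q) + 5 * (c * \<theta>)"
    using c t \<theta> q by (intro add_mono mult_left_mono mult_right_mono) auto
  also have "\<dots> \<le> 3 / 10 * q + 5 * (c * \<theta>)" using q by simp
  finally have "c * ((1 - b) / b) * y\<^sup>2 \<le> (3 / 10 * q + 5 * (c * \<theta>)) * y\<^sup>2"
    by (intro mult_right_mono) auto
  moreover have "(1 - q) * d\<^sup>2 \<le> d\<^sup>2" using q mult_right_mono[of "1-q" 1 "d\<^sup>2"] by simp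
  ultimately show ?thesis using 1 by (simp add: damped_energy_def algebra_simps)
qed

lemma damped_energy_upper:
  assumes \<kappa>: "1 / q \<le> \<kappa>"
  shows "damped_energy c q \<theta> y d \<le> (2 + \<kappa>) * energy q y d"
proof -
  have t: "0 < \<theta>" using c by simp
  have "c * \<theta> \<le> 1 / 12 * (1 / 3)" using c \<theta> t by (intro mult_mono) auto
  hence ct: "6 * c * \<theta> \<le> 1 / 6" by simp
  have kq: "1 \<le> \<kappa> * q" using \<kappa> q by (simp add: field_simps)
  have k: "0 \<le> \<kappa>" using \<kappa> q by (smt (verit) divide_pos_pos)
  have "damped_energy c q \<theta> y d \<le> 5 / 4 * d\<^sup>2 + (13 / 10 * q + 6 * c * \<theta>) * y\<^sup>2" by (rule damped_energy_upper_aux)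
  also have "\<dots> \<le> ((2 + \<kappa>) * (1 - q / 2)) * d\<^sup>2 + ((2 + \<kappa>) * q) * y\<^sup>2"
  proof (intro add_mono mult_right_mono)
    have "2 * (15/16) \<le> (2 + \<kappa>) * (1 - q / 2)" using q k by (intro mult_mono) auto
    thus "5 / 4 \<le> (2 + \<kappa>) * (1 - q / 2)" by simp
    show "13 / 10 * q + 6 * c * \<theta> \<le> (2 + \<kappa>) * q" using ct kq q by (simp add: algebra_simps)
  qed auto
  also have "\<dots> = (2 + \<kappa>) * energy q y d" by (simp add: energy_def algebra_simps)
  finally show ?thesis .
qed

text \<open>Friction removes \<open>15 / 8 * \<theta>\<close> times \<open>d\<^sup>2\<close> from
  the quadratic part. The \<open>c\<close> part spends \<open>\<theta>\<close> times
  \<open>d\<^sup>2\<close> of this to gain a loss of \<open>3 / 2 * (c * q)\<close> times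
  \<open>y\<^sup>2\<close>. What is left dominates \<open>\<tau>\<close> times the upper bound of
  the form.\<close>

lemma damped_energy_step:
  assumes \<tau>: "0 \<le> \<tau>" "\<tau> \<le> c / 3" "\<tau> \<le> q / (12 * \<theta>)"
  shows "damped_energy c q \<theta> ((1 - q) * (y + mom \<theta> * d)) ((1 - q) * (y + mom \<theta> * d) - y) \<le> (1 - \<tau>) * damped_energy c q \<theta> y d"
proof -
  have t: "0 < \<theta>" using c by simp
  define y' d' w where "y' = (1 - q) * (y + mom \<theta> * d)" and "d' = y' - y" and "w = (1 - b) / b"
  have b0: "0 < b" and b1: "b \<le> 1" using b_bounds q by linarith+
  have bw: "b * w = 1 - b" unfolding w_def using b0
    by (metis nonzero_mult_div_cancel_left times_divide_eq_right less_numeral_extra(3))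
  have y': "y' = y + d'" by (simp add: d'_def)
  have d': "d' = b * d - q * y" by (simp add: d'_def y'_def algebra_simps)
  \<comment> \<open>The choice of \<open>w\<close> reproduces the old form with an error that
    consists of squares only.\<close>
  have N: "b * (2 * y' * d' + w * y'\<^sup>2) = b * (2 * y * d + w * y\<^sup>2) + ((1 + b) * d'\<^sup>2 - 2 * q * y\<^sup>2)"
  proof -
    have "b * (2 * y' * d' + w * y'\<^sup>2) = 2 * b * y' * d' + (b * w) * y'\<^sup>2" by (simp add: algebra_simps)
    also have "\<dots> = 2 * b * (y + d') * d' + (1 - b) * (y + d')\<^sup>2" unfolding bw y' ..
    also have "\<dots> = (1 - b) * y\<^sup>2 + 2 * y * d' + (1 + b) * d'\<^sup>2"
      by (simp add: algebra_simps power2_eq_square)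
    also have "2 * y * d' = 2 * b * y * d - 2 * q * y\<^sup>2" unfolding d' by (simp add: algebra_simps power2_eq_square)
    also have "(1 - b) * y\<^sup>2 = b * w * y\<^sup>2" by (simp only: bw)
    finally show ?thesis by (simp add: algebra_simps)
  qed
  have dd: "(1 + b) * d'\<^sup>2 \<le> q / 2 * y\<^sup>2 + 4 * b\<^sup>2 * d\<^sup>2"
  proof -
    have "(1 + b) * d'\<^sup>2 \<le> 2 * d'\<^sup>2" using b1 by (intro mult_right_mono) auto
    also have "d'\<^sup>2 \<le> 2 * q\<^sup>2 * y\<^sup>2 + 2 * b\<^sup>2 * d\<^sup>2"
    proof -
      have "0 \<le> (b * d + q * y)\<^sup>2" by simp
      thus ?thesis unfolding d' by (simp add: power2_eq_square algebra_simps)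
    qed
    hence "2 * d'\<^sup>2 \<le> 4 * q\<^sup>2 * y\<^sup>2 + 4 * b\<^sup>2 * d\<^sup>2" by simp
    also have "4 * q\<^sup>2 \<le> q / 2" using q by (simp add: power2_eq_square)
    hence "4 * q\<^sup>2 * y\<^sup>2 \<le> q / 2 * y\<^sup>2" by (intro mult_right_mono) auto
    finally show ?thesis by simp
  qed
  have "b * (2 * y' * d' + w * y'\<^sup>2) \<le> b * (2 * y * d + w * y\<^sup>2) + (4 * b\<^sup>2 * d\<^sup>2 - 3 / 2 * q * y\<^sup>2)"
    using N dd by simp
  \<comment> \<open>Weakening the gain by the factor \<open>b \<le> 1\<close> allows
    \<open>b\<close> to be cancelled on both sides.\<close>
  also have "\<dots> \<le> b * (2 * y * d + w * y\<^sup>2) + (4 * b\<^sup>2 * d\<^sup>2 - b * (3 / 2 * q * y\<^sup>2))"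
    using b1 q mult_right_mono[of b 1 "3 / 2 * q * y\<^sup>2"] by simp
  also have "\<dots> = b * (2 * y * d + w * y\<^sup>2 + 4 * b * d\<^sup>2 - 3 / 2 * q * y\<^sup>2)"
    by (simp add: algebra_simps power2_eq_square)
  finally have "2 * y' * d' + w * y'\<^sup>2 \<le> 2 * y * d + w * y\<^sup>2 + 4 * b * d\<^sup>2 - 3 / 2 * q * y\<^sup>2"
    using b0 by (simp add: mult_le_cancel_left_pos)
  also have "4 * b * d\<^sup>2 \<le> 4 * d\<^sup>2" using b1 q mult_right_mono[of b 1 "4 * d\<^sup>2"] by simp
  finally have "c * (2 * y' * d' + w * y'\<^sup>2) \<le> c * (2 * y * d + w * y\<^sup>2 + 4 * d\<^sup>2 - 3 / 2 * q * y\<^sup>2)"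
    using c by (intro mult_left_mono) auto
  also have "\<dots> = c * (2 * y * d + w * y\<^sup>2) + (4 * c) * d\<^sup>2 - 3 / 2 * (c * q) * y\<^sup>2"
    by (simp add: algebra_simps)
  also have "(4 * c) * d\<^sup>2 \<le> \<theta> * d\<^sup>2" using c by (intro mult_right_mono) auto
  finally have C: "c * (2 * y' * d' + w * y'\<^sup>2) \<le> c * (2 * y * d + w * y\<^sup>2) + \<theta> * d\<^sup>2 - 3 / 2 * (c * q) * y\<^sup>2"
    by simp
  \<comment> \<open>With the weights \<open>1 - q\<close> and \<open>q\<close> the mixed term
    cancels exactly.\<close>
  have "(1 - q) * d'\<^sup>2 + q * y'\<^sup>2 = (1 - q) * (q * y\<^sup>2 + (1 - q) * (mom \<theta>)\<^sup>2 * d\<^sup>2)"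
    unfolding d'_def y'_def by (simp add: algebra_simps power2_eq_square)
  also have "\<dots> \<le> q * y\<^sup>2 + (1 - q) * (mom \<theta>)\<^sup>2 * d\<^sup>2"
    using q mult_right_mono[of "1-q" 1 "q * y\<^sup>2 + (1 - q) * (mom \<theta>)\<^sup>2 * d\<^sup>2"] by simp
  also have "(1 - q) * (mom \<theta>)\<^sup>2 * d\<^sup>2 \<le> (1 - q) * (1 - 9 / 4 * \<theta>) * d\<^sup>2"
  proof -
    \<comment> \<open>9/4 is the largest constant for which the bound on the squared momentum holds
      up to \<open>\<theta> = 1 / 3\<close>.\<close>
    have "\<theta> * (1 + \<theta>)\<^sup>2 \<le> \<theta> * (4/3)\<^sup>2" using t \<theta> by (intro mult_left_mono power_mono) auto
    hence "(1 - \<theta>)\<^sup>2 \<le> (1 - 9 / 4 * \<theta>) * (1 + \<theta>)\<^sup>2" by (simp add: power2_eq_square algebra_simps)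
    hence "(mom \<theta>)\<^sup>2 \<le> 1 - 9 / 4 * \<theta>" using t by (simp add: mom_def power_divide pos_divide_le_eq)
    thus ?thesis using q by (intro mult_right_mono mult_left_mono) auto
  qed
  also have "(1 - q) * (1 - 9 / 4 * \<theta>) * d\<^sup>2 \<le> (1 - q - 15 / 8 * \<theta>) * d\<^sup>2"
  proof (intro mult_right_mono)
    have "q * \<theta> \<le> 1 / 8 * \<theta>" using q t by (intro mult_right_mono) auto
    moreover have "(1 - q) * (1 - 9 / 4 * \<theta>) = 1 - q - 9 / 4 * \<theta> + 9 / 4 * (q * \<theta>)"
      by (simp add: field_simps)
    ultimately show "(1 - q) * (1 - 9 / 4 * \<theta>) \<le> 1 - q - 15 / 8 * \<theta>" using t by linarith
  qed auto
  finally have "(1 - q) * d'\<^sup>2 + q * y'\<^sup>2 \<le> q * y\<^sup>2 + (1 - q) * d\<^sup>2 - 15 / 8 * \<theta> * d\<^sup>2"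
    by (simp add: algebra_simps)
  with C have drop: "damped_energy c q \<theta> y' d' \<le> damped_energy c q \<theta> y d - 7 / 8 * \<theta> * d\<^sup>2 - 3 / 2 * (c * q) * y\<^sup>2"
    by (simp add: damped_energy_def w_def algebra_simps)
  have "\<tau> * damped_energy c q \<theta> y d \<le> \<tau> * (5 / 4 * d\<^sup>2 + (13 / 10 * q + 6 * c * \<theta>) * y\<^sup>2)"
    using damped_energy_upper_aux \<tau> by (intro mult_left_mono) auto
  also have "\<dots> = (5 / 4 * \<tau>) * d\<^sup>2 + (13 / 10 * (\<tau> * q) + 6 * c * (\<tau> * \<theta>)) * y\<^sup>2"
    by (simp add: algebra_simps)
  also have "\<dots> \<le> (7 / 8 * \<theta>) * d\<^sup>2 + (3 / 2 * (c * q)) * y\<^sup>2"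
  proof (intro add_mono mult_right_mono)
    show "5 / 4 * \<tau> \<le> 7 / 8 * \<theta>" using \<tau> c by simp
    have "\<tau> * q \<le> c / 3 * q" using \<tau> q by (intro mult_right_mono) auto
    moreover have "\<tau> * \<theta> \<le> q / 12" using \<tau> t by (simp add: field_simps)
    hence "c * (\<tau> * \<theta>) \<le> c * (q / 12)" using c by (intro mult_left_mono) auto
    moreover have "0 < c * q" using c q by simp
    ultimately show "13 / 10 * (\<tau> * q) + 6 * c * (\<tau> * \<theta>) \<le> 3 / 2 * (c * q)"
      by (simp add: algebra_simps)
  qed auto
  finally have "damped_energy c q \<theta> y' d' \<le> (1 - \<tau>) * damped_energy c q \<theta> y d"
    using drop by (simp add: algebra_simps)
  thus ?thesis by (simp add: y'_def d'_def)
qed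

lemma damped_energy_mono:
  assumes \<theta>': "\<theta>' \<le> \<theta>" "c \<le> \<theta>' / 4"
  shows "damped_energy c q \<theta>' y d \<le> damped_energy c q \<theta> y d"
proof -
  have "(1 - q) * mom \<theta> \<le> (1 - q) * mom \<theta>'"
    using mom_antimono[of \<theta>' \<theta>] \<theta>' c q by (intro mult_left_mono) auto
  moreover have b0: "0 < b" using b_bounds by linarith
  moreover have "(1 - x) / x \<le> (1 - z) / z" if "z \<le> x" "0 < z" for x z :: real
    using that by (simp add: diff_divide_distrib frac_le)
  ultimately have "(1 - (1 - q) * mom \<theta>') / ((1 - q) * mom \<theta>') \<le> (1 - b) / b" by blast
  thus ?thesis unfolding damped_energy_def using c
    by (intro add_left_mono mult_left_mono mult_right_mono) auto
qed

end

text \<open>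
  For large \<open>\<theta>\<close> or \<open>q\<close>, where \<open>(1 - b) / b\<close> degenerates, the plain energy decays fast enough. Its weight
  \<open>2 + \<kappa>\<close> makes the switch to \<^const>\<open>damped_energy\<close> a decrease.
\<close>

definition potential :: "real \<Rightarrow> real \<Rightarrow> real \<Rightarrow> real \<Rightarrow> real \<Rightarrow> real \<Rightarrow> real" where
  "potential \<kappa> c q \<theta> y d = (if \<theta> > 1 / 3 \<or> q > 1 / 8 then (2 + \<kappa>) * energy q y d else damped_energy c q \<theta> y d)"

text \<open>A perturbation of the new point shifts the point and its increment alike, hence the same
  \<open>r\<close> in both arguments.\<close>

lemma energy_perturb:
  assumes "0 \<le> q" "q \<le> 1" "0 < \<nu>"
  shows "energy q (y + r) (d + r) \<le> (1 + \<nu>) * energy q y d + (1 + 1 / \<nu>) * (2 * r\<^sup>2)"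
proof -
  have "energy q (y + r) (d + r) \<le> (1 + \<nu>) * energy q y d + (1 + 1 / \<nu>) * energy q r r"
    by (rule quadratic_form_perturb[where A = q and B = 0 and C = "1 - q / 2"])
       (use assms energy_nonneg in \<open>auto simp: energy_def\<close>)
  also have "energy q r r = (1 + q / 2) * r\<^sup>2" by (simp add: energy_def algebra_simps)
  also have "(1 + 1 / \<nu>) * ((1 + q / 2) * r\<^sup>2) \<le> (1 + 1 / \<nu>) * (2 * r\<^sup>2)"
    using assms by (intro mult_left_mono mult_right_mono) auto
  finally show ?thesis by simp
qed

text \<open>Half of a contraction rate pays for the factor \<open>1 + \<tau> / 2\<close> of the
  perturbation inequality.\<close>

lemma rate_absorb:
  fixes \<tau> x :: real
  assumes "0 < \<tau>" "0 \<le> x"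
  shows "(1 + \<tau> / 2) * ((1 - \<tau>) * x) \<le> (1 - \<tau> / 2) * x"
proof -
  have "(1 + \<tau> / 2) * (1 - \<tau>) \<le> 1 - \<tau> / 2" by (simp add: algebra_simps)
  thus ?thesis using mult_right_mono[OF _ assms(2)] by (metis mult.assoc)
qed

lemma energy_step_perturb:
  assumes q: "0 \<le> q" "q \<le> 1" and \<beta>: "0 \<le> \<beta>" "\<beta> \<le> 1" and \<tau>: "0 < \<tau>" "\<tau> \<le> q / 2"
    and y': "y' = (1 - q) * (y + \<beta> * d) + r"
  shows "energy q y' (y' - y) \<le> (1 - \<tau> / 2) * energy q y d + (1 + 2 / \<tau>) * (2 * r\<^sup>2)"
proof -
  define z where "z = (1 - q) * (y + \<beta> * d)"
  have "energy q (z + r) ((z - y) + r) \<le> (1 + \<tau> / 2) * energy q z (z - y) + (1 + 1 / (\<tau> / 2)) * (2 * r\<^sup>2)"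
    using q \<tau> by (intro energy_perturb) auto
  also have "energy q z (z - y) \<le> (1 - q / 2) * energy q y d" unfolding z_def by (rule energy_step[OF q \<beta>])
  hence "energy q z (z - y) \<le> (1 - \<tau>) * energy q y d"
    using mult_right_mono[of "1 - q/2" "1 - \<tau>" "energy q y d"] energy_nonneg[of q y d] q \<tau> by linarith
  hence "(1 + \<tau> / 2) * energy q z (z - y) \<le> (1 + \<tau> / 2) * ((1 - \<tau>) * energy q y d)"
    using \<tau> by (intro mult_left_mono) auto
  also have "\<dots> \<le> (1 - \<tau> / 2) * energy q y d" using \<tau> energy_nonneg q by (intro rate_absorb) auto
  finally show ?thesis by (simp add: y' z_def algebra_simps)
qed

context
  fixes c q \<theta> \<kappa> :: real
  assumes c: "0 < c" "c \<le> \<theta> / 4" and q: "0 < q" "q \<le> 1" and \<kappa>: "1 / q \<le> \<kappa>" and t1: "\<theta> \<le> 1"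
begin

private lemma k0: "0 \<le> \<kappa>" using \<kappa> q by (smt (verit) divide_pos_pos)

lemma potential_upper: "potential \<kappa> c q \<theta> y d \<le> (2 + \<kappa>) * energy q y d"
  using damped_energy_upper[of c \<theta> q \<kappa> y d] c q \<kappa> by (auto simp: potential_def)

lemma potential_lower: "energy q y d / 3 \<le> potential \<kappa> c q \<theta> y d"
proof -
  have "energy q y d / 3 \<le> (2 + \<kappa>) * energy q y d"
    using mult_right_mono[of "1/3" "2 + \<kappa>" "energy q y d"] energy_nonneg[of q y d] q k0 by simp
  thus ?thesis using damped_energy_lower[of c \<theta> q y d] c q by (auto simp: potential_def)
qed

lemma potential_nonneg: "0 \<le> potential \<kappa> c q \<theta> y d"
  using potential_lower[of y d] energy_nonneg[of q y d] q by simp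

lemma potential_mono:
  assumes \<theta>': "\<theta>' \<le> \<theta>" "c \<le> \<theta>' / 4"
  shows "potential \<kappa> c q \<theta>' y d \<le> potential \<kappa> c q \<theta> y d"
proof (cases "\<theta> > 1 / 3 \<or> q > 1 / 8")
  case True
  thus ?thesis using damped_energy_upper[of c \<theta>' q \<kappa> y d] c q \<kappa> \<theta>' by (auto simp: potential_def)
next
  case False
  thus ?thesis using damped_energy_mono[of c \<theta> q \<theta>' y d] c q \<theta>' by (auto simp: potential_def)
qed

lemma potential_perturb:
  assumes "0 < \<nu>"
  shows "potential \<kappa> c q \<theta> (y + r) (d + r) \<le> (1 + \<nu>) * potential \<kappa> c q \<theta> y d + (1 + 1 / \<nu>) * ((2 + \<kappa>) * (2 * r\<^sup>2))"
proof -
  define A where "A = (if \<theta> > 1 / 3 \<or> q > 1 / 8 then (2 + \<kappa>) * q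
    else q + c * ((1 - (1 - q) * mom \<theta>) / ((1 - q) * mom \<theta>)))"
  define B where "B = (if \<theta> > 1 / 3 \<or> q > 1 / 8 then 0 else 2 * c)"
  define C where "C = (if \<theta> > 1 / 3 \<or> q > 1 / 8 then (2 + \<kappa>) * (1 - q / 2) else 1 - q)"
  have "potential \<kappa> c q \<theta> (y + r) (d + r) \<le> (1 + \<nu>) * potential \<kappa> c q \<theta> y d + (1 + 1 / \<nu>) * potential \<kappa> c q \<theta> r r"
    by (rule quadratic_form_perturb[where A = A and B = B and C = C])
       (use assms potential_nonneg in \<open>auto simp: A_def B_def C_def potential_def energy_def damped_energy_def algebra_simps\<close>)
  also have "potential \<kappa> c q \<theta> r r \<le> (2 + \<kappa>) * (2 * r\<^sup>2)"
  proof -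
    have "energy q r r = (1 + q / 2) * r\<^sup>2" by (simp add: energy_def algebra_simps)
    also have "\<dots> \<le> 2 * r\<^sup>2" using q by (intro mult_right_mono) auto
    finally have "(2 + \<kappa>) * energy q r r \<le> (2 + \<kappa>) * (2 * r\<^sup>2)" using k0 by (intro mult_left_mono) auto
    thus ?thesis using potential_upper[of r r] by linarith
  qed
  hence "(1 + 1 / \<nu>) * potential \<kappa> c q \<theta> r r \<le> (1 + 1 / \<nu>) * ((2 + \<kappa>) * (2 * r\<^sup>2))"
    using assms by (intro mult_left_mono) auto
  finally show ?thesis by simp
qed

lemma potential_step:
  assumes \<tau>: "0 \<le> \<tau>" "\<tau> \<le> c / 3" "\<tau> \<le> q / (12 * \<theta>)"
  shows "potential \<kappa> c q \<theta> ((1 - q) * (y + mom \<theta> * d)) ((1 - q) * (y + mom \<theta> * d) - y) \<le> (1 - \<tau>) * potential \<kappa> c q \<theta> y d"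
proof (cases "\<theta> > 1 / 3 \<or> q > 1 / 8")
  case True
  have t: "0 < \<theta>" using c by simp
  \<comment> \<open>This makes the rate of the plain energy sufficient. For
    \<open>\<theta> > 1 / 3\<close> it follows from the third bound on \<open>\<tau>\<close>;
    otherwise \<open>q > 1 / 8\<close>, while \<open>\<tau>\<close> is at most
    \<open>\<theta> / 12\<close> and hence at most 1/36.\<close>
  have "\<tau> \<le> q / 2"
  proof (cases "\<theta> > 1 / 3")
    case True
    have "q / (12 * \<theta>) \<le> q / 2" using q True by (intro divide_left_mono) auto
    thus ?thesis using \<tau> by simp
  next
    case False
    thus ?thesis using True \<tau> c by simp
  qed
  have "energy q ((1 - q) * (y + mom \<theta> * d)) ((1 - q) * (y + mom \<theta> * d) - y) \<le> (1 - q / 2) * energy q y d"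
    using q t t1 mom_bounds[of \<theta>] by (intro energy_step) auto
  also have "\<dots> \<le> (1 - \<tau>) * energy q y d"
    using \<open>\<tau> \<le> q / 2\<close> energy_nonneg q by (intro mult_right_mono) auto
  finally have "(2 + \<kappa>) * energy q ((1 - q) * (y + mom \<theta> * d)) ((1 - q) * (y + mom \<theta> * d) - y)
      \<le> (2 + \<kappa>) * ((1 - \<tau>) * energy q y d)" using k0 by (intro mult_left_mono) auto
  thus ?thesis using True by (simp add: potential_def algebra_simps)
next
  case False
  thus ?thesis using damped_energy_step[of c \<theta> q \<tau> y d] c q \<tau> by (simp add: potential_def)
qed

text \<open>The step runs with the old damping \<open>\<theta>\<close>; replacing it by
  \<open>\<theta>'\<close> afterwards is a decrease by monotonicity.\<close>

lemma potential_step_perturb: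
  assumes \<tau>: "0 < \<tau>" "\<tau> \<le> c / 3" "\<tau> \<le> q / (12 * \<theta>)" and \<theta>': "\<theta>' \<le> \<theta>" "c \<le> \<theta>' / 4"
    and y': "y' = (1 - q) * (y + mom \<theta> * d) + r"
  shows "potential \<kappa> c q \<theta>' y' (y' - y) \<le> (1 - \<tau> / 2) * potential \<kappa> c q \<theta> y d + (1 + 2 / \<tau>) * ((2 + \<kappa>) * (2 * r\<^sup>2))"
proof -
  define z where "z = (1 - q) * (y + mom \<theta> * d)"
  have "potential \<kappa> c q \<theta>' y' (y' - y) \<le> potential \<kappa> c q \<theta> y' (y' - y)" by (rule potential_mono[OF \<theta>'])
  also have "\<dots> = potential \<kappa> c q \<theta> (z + r) ((z - y) + r)" by (simp add: y' z_def algebra_simps)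
  also have "\<dots> \<le> (1 + \<tau> / 2) * potential \<kappa> c q \<theta> z (z - y) + (1 + 1 / (\<tau> / 2)) * ((2 + \<kappa>) * (2 * r\<^sup>2))"
    using \<tau> by (intro potential_perturb) auto
  also have "potential \<kappa> c q \<theta> z (z - y) \<le> (1 - \<tau>) * potential \<kappa> c q \<theta> y d"
    unfolding z_def using \<tau> by (intro potential_step) auto
  hence "(1 + \<tau> / 2) * potential \<kappa> c q \<theta> z (z - y) \<le> (1 + \<tau> / 2) * ((1 - \<tau>) * potential \<kappa> c q \<theta> y d)"
    using \<tau> by (intro mult_left_mono) auto
  also have "\<dots> \<le> (1 - \<tau> / 2) * potential \<kappa> c q \<theta> y d" using \<tau> potential_nonneg by (intro rate_absorb) auto
  finally show ?thesis by simp
qed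

end

section \<open>Families of modes\<close>

text \<open>
  \<open>X i t\<close> and \<open>Y i t\<close> are the coordinates of \<open>x\<^sub>t - x\<^sup>\<star>\<close> and \<open>y\<^sub>t - x\<^sup>\<star>\<close> along the \<open>i\<close>-th eigenvector,
  \<open>q i = \<lambda>\<^sub>i / L\<^sub>0\<close>, \<open>r\<close> is the nonlinear part of the gradient divided by \<open>- L\<^sub>0\<close>, and
  \<open>\<theta> t = sqrt (m\<^bsub>t-1\<^esub> / L\<^sub>0)\<close>.
\<close>

locale nag_modes =
  fixes I :: "nat set" and q :: "nat \<Rightarrow> real" and X Y D r :: "nat \<Rightarrow> nat \<Rightarrow> real"
    and \<theta> :: "nat \<Rightarrow> real" and \<kappa> :: real
  assumes fin: "finite I" and \<kappa>: "4 \<le> \<kappa>" and q_lower: "\<And>i. i \<in> I \<Longrightarrow> 1 / \<kappa> \<le> q i"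
    and q_upper: "\<And>i. i \<in> I \<Longrightarrow> q i \<le> 1"
    and D_0: "\<And>i. D i 0 = 0" and X_eq: "\<And>i t. X i t = Y i t + mom (\<theta> t) * D i t"
    and Y_Suc: "\<And>i t. Y i (Suc t) = (1 - q i) * X i t + r i t"
    and D_Suc: "\<And>i t. D i (Suc t) = Y i (Suc t) - Y i t"
    and \<theta>_0: "\<theta> 0 = 1" and \<theta>_nonneg: "\<And>t. 0 \<le> \<theta> t" and \<theta>_Suc: "\<And>t. \<theta> (Suc t) \<le> \<theta> t"
begin

text \<open>In the application Parseval makes \<open>S t\<close> the squared distance of x_t to the
  minimizer and \<open>R t\<close> the squared norm of the nonlinear gradient part divided by
  \<open>L0\<close>.\<close>

definition S :: "nat \<Rightarrow> real" where "S t = (\<Sum>i\<in>I. (X i t)\<^sup>2)"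
definition R :: "nat \<Rightarrow> real" where "R t = (\<Sum>i\<in>I. (r i t)\<^sup>2)"
definition \<Phi> :: "nat \<Rightarrow> real" where "\<Phi> t = (\<Sum>i\<in>I. energy (q i) (Y i t) (D i t))"

lemma \<theta>_antimono: "s \<le> t \<Longrightarrow> \<theta> t \<le> \<theta> s"
  by (rule lift_Suc_antimono_le[of \<theta>]) (rule \<theta>_Suc)

lemma \<theta>_le_1: "\<theta> t \<le> 1"
  using \<theta>_antimono[of 0 t] \<theta>_0 by simp

lemma mom_\<theta>: "0 \<le> mom (\<theta> t)" "mom (\<theta> t) \<le> 1"
  using mom_bounds[OF \<theta>_nonneg \<theta>_le_1] by auto

lemma q_pos: "i \<in> I \<Longrightarrow> 0 < q i"
  using q_lower[of i] \<kappa> by (smt (verit) divide_pos_pos)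

lemma S_nonneg: "0 \<le> S t" and R_nonneg: "0 \<le> R t"
  by (auto simp: S_def R_def intro: sum_nonneg)

lemma X_0: "X i 0 = Y i 0"
  by (simp add: X_eq D_0)

lemma X_le_energy:
  assumes "i \<in> I"
  shows "(X i t)\<^sup>2 \<le> 3 * \<kappa> * energy (q i) (Y i t) (D i t)"
proof -
  let ?m = "mom (\<theta> t)"
  have "(X i t)\<^sup>2 \<le> 2 * (Y i t)\<^sup>2 + 2 * (?m * D i t)\<^sup>2"
    using zero_le_power2[of "Y i t - ?m * D i t"] by (simp add: X_eq power2_eq_square algebra_simps)
  also have "(?m * D i t)\<^sup>2 \<le> (D i t)\<^sup>2"
    using mom_\<theta>[of t] by (simp add: power_mult_distrib mult_left_le_one_le power_le_one)
  also have "2 * (Y i t)\<^sup>2 + 2 * (D i t)\<^sup>2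
      \<le> (3 * \<kappa> * q i) * (Y i t)\<^sup>2 + (3 * \<kappa> * (1 - q i / 2)) * (D i t)\<^sup>2"
  proof (intro add_mono mult_right_mono)
    show "2 \<le> 3 * \<kappa> * q i" using q_lower[OF assms] \<kappa> by (simp add: field_simps)
    have "3 * 4 * (1 / 2) \<le> 3 * \<kappa> * (1 - q i / 2)"
      using q_upper[OF assms] \<kappa> by (intro mult_mono) auto
    thus "2 \<le> 3 * \<kappa> * (1 - q i / 2)" by simp
  qed auto
  finally show ?thesis by (simp add: energy_def algebra_simps)
qed

lemma S_le_\<Phi>: "S t \<le> 3 * \<kappa> * \<Phi> t"
  unfolding S_def \<Phi>_def sum_distrib_left by (intro sum_mono X_le_energy)

lemma S_le_if_\<Phi>_le: "\<Phi> t \<le> x \<Longrightarrow> S t \<le> 3 * \<kappa> * x"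
  using order_trans[OF S_le_\<Phi> mult_left_mono] \<kappa> by simp

lemma \<Phi>_nonneg: "0 \<le> \<Phi> t"
  unfolding \<Phi>_def using q_pos q_upper by (intro sum_nonneg energy_nonneg) (auto intro: less_imp_le)

lemma \<Phi>_0: "\<Phi> 0 \<le> S 0"
  unfolding \<Phi>_def S_def using q_upper
  by (intro sum_mono) (auto simp: energy_def D_0 X_0 intro!: mult_left_le_one_le dest: q_pos)

lemma \<Phi>_Suc: "\<Phi> (Suc t) \<le> (1 - 1 / (4 * \<kappa>)) * \<Phi> t + (1 + 4 * \<kappa>) * (2 * R t)"
proof -
  have "\<Phi> (Suc t) \<le> (\<Sum>i\<in>I. (1 - 1 / (4 * \<kappa>)) * energy (q i) (Y i t) (D i t) + (1 + 4 * \<kappa>) * (2 * (r i t)\<^sup>2))"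
    unfolding \<Phi>_def
  proof (rule sum_mono)
    fix i assume i: "i \<in> I"
    have "energy (q i) (Y i (Suc t)) (Y i (Suc t) - Y i t)
        \<le> (1 - (1 / (2 * \<kappa>)) / 2) * energy (q i) (Y i t) (D i t) + (1 + 2 / (1 / (2 * \<kappa>))) * (2 * (r i t)\<^sup>2)"
      using q_lower[OF i] q_pos[OF i] q_upper[OF i] mom_\<theta>[of t] \<kappa>
      by (intro energy_step_perturb[where \<beta> = "mom (\<theta> t)"]) (auto simp: Y_Suc X_eq)
    thus "energy (q i) (Y i (Suc t)) (D i (Suc t))
        \<le> (1 - 1 / (4 * \<kappa>)) * energy (q i) (Y i t) (D i t) + (1 + 4 * \<kappa>) * (2 * (r i t)\<^sup>2)"
      by (simp add: D_Suc)
  qed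
  thus ?thesis by (simp add: \<Phi>_def R_def sum.distrib sum_distrib_left)
qed

text \<open>Through \<open>S_le_\<Phi>\<close> the perturbation is a multiple of
  \<open>\<Phi>\<close> itself; the bound on \<open>h\<close> limits it to
  \<open>1 / (8 * \<kappa>)\<close>, half of the available rate.\<close>

lemma \<Phi>_decay:
  assumes "R t \<le> h * S t" and h: "0 \<le> h" "h * (48 * \<kappa>\<^sup>2 * (1 + 4 * \<kappa>)) \<le> 1"
  shows "\<Phi> (Suc t) \<le> (1 - 1 / (8 * \<kappa>)) * \<Phi> t"
proof -
  have "(1 + 4 * \<kappa>) * (2 * R t) \<le> (1 + 4 * \<kappa>) * (2 * (h * (3 * \<kappa> * \<Phi> t)))"
    using assms S_le_\<Phi>[of t] \<kappa> h mult_left_mono[OF S_le_\<Phi>[of t] h(1)] by (intro mult_left_mono) auto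
  also have "\<dots> = (h * (48 * \<kappa>\<^sup>2 * (1 + 4 * \<kappa>))) * (\<Phi> t / (8 * \<kappa>))"
    using \<kappa> by (simp add: field_simps power2_eq_square)
  also have "\<dots> \<le> 1 * (\<Phi> t / (8 * \<kappa>))"
    using h \<kappa> \<Phi>_nonneg[of t] by (intro mult_right_mono) auto
  finally show ?thesis using \<Phi>_Suc[of t] \<kappa> by (simp add: field_simps)
qed

text \<open>A bootstrap: smallness is known only on the ball \<open>S t \<le> \<rho>\<close>, but as
  long as it holds \<open>\<Phi>\<close> does not grow, and \<open>S t\<close> stays below
  \<open>3 * \<kappa> * S 0\<close>, hence in the ball.\<close>

lemma perturbation_small:
  assumes "\<And>t. S t \<le> \<rho> \<Longrightarrow> R t \<le> h * S t" and S_0: "3 * \<kappa> * S 0 \<le> \<rho>"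
    and h: "0 \<le> h" "h * (48 * \<kappa>\<^sup>2 * (1 + 4 * \<kappa>)) \<le> 1"
  shows "R t \<le> h * S t"
proof -
  have S: "S t \<le> \<rho>" if "\<Phi> t \<le> S 0" for t
    using S_le_if_\<Phi>_le[OF that] S_0 by linarith
  have "\<Phi> t \<le> S 0" for t
  proof (induction t)
    case (Suc t)
    have "\<Phi> (Suc t) \<le> (1 - 1 / (8 * \<kappa>)) * \<Phi> t"
      using \<Phi>_decay[OF assms(1)[OF S[OF Suc]] h] .
    also have "\<dots> \<le> 1 * \<Phi> t" using \<kappa> \<Phi>_nonneg[of t] by (intro mult_right_mono) auto
    finally show ?case using Suc by simp
  qed (rule \<Phi>_0)
  thus ?thesis using assms(1) S by blast
qed

end

section \<open>Decay estimates when the perturbation is small along the whole trajectory\<close>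

locale nag_modes_perturbed = nag_modes +
  fixes h :: real
  assumes h_nonneg: "0 \<le> h" and h_small: "h * (48 * \<kappa>\<^sup>2 * (1 + 4 * \<kappa>)) \<le> 1"
    and R_le: "\<And>t. R t \<le> h * S t"
begin

lemma \<Phi>_decay_power: "\<Phi> t \<le> (1 - 1 / (8 * \<kappa>)) ^ t * S 0"
proof (induction t)
  case (Suc t)
  have "0 \<le> 1 - 1 / (8 * \<kappa>)" using \<kappa> by simp
  hence "(1 - 1 / (8 * \<kappa>)) * \<Phi> t \<le> (1 - 1 / (8 * \<kappa>)) * ((1 - 1 / (8 * \<kappa>)) ^ t * S 0)"
    using Suc by (intro mult_left_mono) auto
  thus ?case using \<Phi>_decay[OF R_le[of t] h_nonneg h_small] by simp
qed (use \<Phi>_0 in simp)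

lemma \<Phi>_le: "\<Phi> t \<le> S 0"
proof -
  have "(1 - 1 / (8 * \<kappa>)) ^ t \<le> 1" using \<kappa> by (intro power_le_one) auto
  hence "(1 - 1 / (8 * \<kappa>)) ^ t * S 0 \<le> 1 * S 0" using S_nonneg by (intro mult_right_mono) auto
  thus ?thesis using \<Phi>_decay_power[of t] by simp
qed

lemma S_decay_power: "S t \<le> 3 * \<kappa> * ((1 - 1 / (8 * \<kappa>)) ^ t * S 0)"
  by (rule S_le_if_\<Phi>_le[OF \<Phi>_decay_power])

lemma S_le: "S t \<le> 3 * \<kappa> * S 0"
  by (rule S_le_if_\<Phi>_le[OF \<Phi>_le])

text \<open>\<open>c\<close> is limited by the smallest damping up to \<open>N\<close>, and
  \<open>B\<close> bounds the largest one from \<open>T\<close> on. With both of order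
  \<open>1 / sqrt \<kappa>\<close> the two bounds on \<open>\<tau>\<close> have that order too,
  which is acceleration. Half of the rate \<open>\<tau> / 2\<close> is given up to the
  perturbation.\<close>

lemma fast_phase:
  assumes T: "T \<le> N" and c: "0 < c" "\<And>t. t \<le> N \<Longrightarrow> c \<le> \<theta> t / 4"
    and B: "\<theta> T \<le> B" and \<tau>: "0 < \<tau>" "\<tau> \<le> c / 3" "\<tau> \<le> 1 / (12 * \<kappa> * B)"
    and h: "h * (72 * \<kappa> * (2 + \<kappa>) * (1 + 2 / \<tau>)) \<le> \<tau>"
  shows "S N \<le> 9 * \<kappa> * (2 + \<kappa>) * ((1 - \<tau> / 4) ^ (N - T) * S 0)"
proof -
  define \<Psi> where "\<Psi> t = (\<Sum>i\<in>I. potential \<kappa> c (q i) (\<theta> t) (Y i t) (D i t))" for t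
  have qk: "1 / q i \<le> \<kappa>" if "i \<in> I" for i
    using q_lower[OF that] q_pos[OF that] \<kappa> by (simp add: field_simps)
  note pot_assms = c(1) c(2) q_pos q_upper qk \<theta>_le_1
  have \<Phi>\<Psi>: "\<Phi> t \<le> 3 * \<Psi> t" if "t \<le> N" for t
  proof -
    have "\<Phi> t / 3 \<le> \<Psi> t" unfolding \<Psi>_def \<Phi>_def sum_divide_distrib
      by (intro sum_mono potential_lower) (use pot_assms that in auto)
    thus ?thesis by simp
  qed
  have c3: "c / 3 \<le> 1" using c(2)[of T] T \<theta>_le_1[of T] by simp
  have step: "\<Psi> (Suc t) \<le> (1 - \<tau> / 4) * \<Psi> t" if t: "T \<le> t" "Suc t \<le> N" for t
  proof -
    have \<theta>t: "\<theta> t \<le> B" "0 < \<theta> t" using \<theta>_antimono[OF t(1)] B c(1) c(2)[of t] t by auto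
    have "\<Psi> (Suc t) \<le> (\<Sum>i\<in>I. (1 - \<tau> / 2) * potential \<kappa> c (q i) (\<theta> t) (Y i t) (D i t) +
        (1 + 2 / \<tau>) * ((2 + \<kappa>) * (2 * (r i t)\<^sup>2)))"
      unfolding \<Psi>_def
    proof (rule sum_mono)
      fix i assume i: "i \<in> I"
      have "\<tau> \<le> 1 / (12 * \<kappa> * B)" by fact
      also have "\<dots> \<le> 1 / (12 * \<kappa> * \<theta> t)"
        using \<theta>t \<kappa> by (intro divide_left_mono mult_left_mono mult_pos_pos) auto
      also have "\<dots> = (1 / \<kappa>) / (12 * \<theta> t)" by simp
      also have "\<dots> \<le> q i / (12 * \<theta> t)" using q_lower[OF i] \<theta>t by (intro divide_right_mono) auto
      finally have "\<tau> \<le> q i / (12 * \<theta> t)" .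
      thus "potential \<kappa> c (q i) (\<theta> (Suc t)) (Y i (Suc t)) (D i (Suc t))
        \<le> (1 - \<tau> / 2) * potential \<kappa> c (q i) (\<theta> t) (Y i t) (D i t) + (1 + 2 / \<tau>) * ((2 + \<kappa>) * (2 * (r i t)\<^sup>2))"
        unfolding D_Suc using pot_assms i t \<tau> \<theta>_Suc[of t]
        by (intro potential_step_perturb) (auto simp: Y_Suc X_eq)
    qed
    also have "\<dots> = (1 - \<tau> / 2) * \<Psi> t + (1 + 2 / \<tau>) * ((2 + \<kappa>) * (2 * R t))"
      by (simp add: \<Psi>_def R_def sum.distrib sum_distrib_left)
    also have "R t \<le> h * (9 * \<kappa> * \<Psi> t)"
    proof -
      have "S t \<le> 3 * \<kappa> * (3 * \<Psi> t)"
        using t by (intro S_le_if_\<Phi>_le \<Phi>\<Psi>) auto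
      hence "h * S t \<le> h * (9 * \<kappa> * \<Psi> t)" using h_nonneg by (intro mult_left_mono) auto
      thus ?thesis using R_le[of t] by simp
    qed
    hence "(1 + 2 / \<tau>) * ((2 + \<kappa>) * (2 * R t)) \<le> (1 + 2 / \<tau>) * ((2 + \<kappa>) * (2 * (h * (9 * \<kappa> * \<Psi> t))))"
      using \<tau> \<kappa> by (intro mult_left_mono) auto
    also have "\<dots> = (h * (72 * \<kappa> * (2 + \<kappa>) * (1 + 2 / \<tau>))) * (\<Psi> t / 4)" by (simp add: algebra_simps)
    also have "\<dots> \<le> \<tau> * (\<Psi> t / 4)"
      using h \<Phi>\<Psi>[of t] \<Phi>_nonneg[of t] t by (intro mult_right_mono) auto
    finally show ?thesis by (simp add: algebra_simps)
  qed
  have "\<Psi> (T + n) \<le> (1 - \<tau> / 4) ^ n * \<Psi> T" if "T + n \<le> N" for n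
    using that
  proof (induction n)
    case (Suc n)
    have "\<Psi> (T + Suc n) \<le> (1 - \<tau> / 4) * \<Psi> (T + n)" using step[of "T + n"] Suc.prems by simp
    also have "\<dots> \<le> (1 - \<tau> / 4) * ((1 - \<tau> / 4) ^ n * \<Psi> T)"
      using Suc \<tau> c3 by (intro mult_left_mono) auto
    finally show ?case by simp
  qed simp
  from this[of "N - T"] T have "\<Psi> N \<le> (1 - \<tau> / 4) ^ (N - T) * \<Psi> T" by simp
  also have "\<Psi> T \<le> (2 + \<kappa>) * \<Phi> T" unfolding \<Psi>_def \<Phi>_def sum_distrib_left
    by (intro sum_mono potential_upper) (use pot_assms T in auto)
  also have "(2 + \<kappa>) * \<Phi> T \<le> (2 + \<kappa>) * S 0" using \<Phi>_le[of T] \<kappa> by (intro mult_left_mono) auto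
  finally have "\<Psi> N \<le> (1 - \<tau> / 4) ^ (N - T) * ((2 + \<kappa>) * S 0)"
    using \<tau> c3 by (simp add: mult_left_mono)
  hence "3 * \<kappa> * (3 * \<Psi> N) \<le> 3 * \<kappa> * (3 * ((1 - \<tau> / 4) ^ (N - T) * ((2 + \<kappa>) * S 0)))"
    using \<kappa> by (intro mult_left_mono) auto
  moreover have "S N \<le> 3 * \<kappa> * (3 * \<Psi> N)"
    by (intro S_le_if_\<Phi>_le \<Phi>\<Psi>) auto
  ultimately show ?thesis by (simp add: algebra_simps)
qed

end

section \<open>The phase of strong damping\<close>

text \<open>The mode is overdamped: the ratio of increment to position stays between
  \<open>- 2 * q / \<theta>\<close> and 0. So it decays no faster than by
  \<open>1 - 2 * q / \<theta>\<close> per step, yet moves by at least \<open>3 / 4 * q * a\<close>,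
  which later bounds the displacement of the iterates from below.\<close>

lemma slow_mode_step:
  fixes q \<theta> a e \<rho> :: real
  assumes q: "0 < q" "q \<le> 1 / 144" and \<theta>: "0 < \<theta>" "\<theta> \<le> 1" "144 * q \<le> \<theta>\<^sup>2"
    and a: "0 < a" and e: "e \<le> 0" "- (2 * q / \<theta> * a) \<le> e" and \<rho>: "\<bar>\<rho>\<bar> \<le> q / 16 * a"
    and a': "a' = (1 - q) * (a + mom \<theta> * e) + \<rho>"
  shows "- (2 * q / \<theta> * a') \<le> a' - a" "a' - a \<le> - (3 / 4 * q * a)" "(1 - 2 * q / \<theta>) * a \<le> a'"
    "a \<le> 2 * a'"
proof -
  define k b where "k = 2 * q / \<theta>" and "b = (1 - q) * mom \<theta>"
  have m: "0 \<le> mom \<theta>" "mom \<theta> \<le> 1" using mom_bounds \<theta> by auto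
  have b: "0 \<le> b" "b \<le> 1" using m q mult_mono[of "1 - q" 1 "mom \<theta>" 1] by (auto simp: b_def)
  have k\<theta>: "k * \<theta> = 2 * q" using \<theta> by (simp add: k_def)
  have "72 * (k * \<theta>) \<le> \<theta> * \<theta>" using \<theta> k\<theta> by (simp add: power2_eq_square)
  hence "72 * k \<le> \<theta>" using \<theta> by (simp add: field_simps)
  hence k: "0 < k" "k \<le> 1 / 72" using q \<theta> by (simp add: k_def, linarith)
  have kk: "k\<^sup>2 \<le> q / 36"
  proof -
    have "k * (72 * k) \<le> k * \<theta>" using k \<open>72 * k \<le> \<theta>\<close> by (intro mult_left_mono) auto
    thus ?thesis using k\<theta> by (simp add: power2_eq_square)
  qed
  have d: "a' - a = b * e - q * a + \<rho>" by (simp add: a' b_def algebra_simps)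
  have be: "- (k * a) \<le> e" using e by (simp add: k_def)
  have "b * e \<le> 0" using b e by (simp add: mult_nonneg_nonpos)
  thus "a' - a \<le> - (3 / 4 * q * a)" using \<rho> q a mult_pos_pos[OF q(1) a] unfolding d by linarith
  have "- (b * (1 + k) * (k * a)) \<le> b * (1 + k) * e"
    using mult_left_mono[OF be, of "b * (1 + k)"] b k by simp
  moreover have "(1 + k) * \<bar>\<rho>\<bar> \<le> 2 * (q / 16 * a)" using k \<rho> by (intro mult_mono) auto
  moreover have "(1 + k) * (- \<rho>) \<le> (1 + k) * \<bar>\<rho>\<bar>" using k by (intro mult_left_mono) auto
  ultimately have "- (b * (1 + k) * (k * a)) \<le> b * (1 + k) * e" "- (q / 8 * a) \<le> (1 + k) * \<rho>" by argo+
  \<comment> \<open>Since \<open>k * \<theta> = 2 * q\<close>, the friction term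
    \<open>k * (1 - mom \<theta>)\<close> is at least \<open>2 * q\<close>. It pays for the gradient
    step \<open>q\<close>, the perturbation \<open>q / 8\<close> and the second-order term
    \<open>k\<^sup>2 \<le> q / 36\<close>.\<close>
  moreover have "0 \<le> (k * (1 - q) - q - b * (1 + k) * k - q / 8) * a"
  proof -
    have "k * (1 - q) - b * k = (1 - q) * (k * (1 - mom \<theta>))" by (simp add: b_def algebra_simps)
    also have "1 - mom \<theta> = 2 * \<theta> / (1 + \<theta>)" using \<theta> by (simp add: mom_def field_simps)
    also have "k * (2 * \<theta> / (1 + \<theta>)) = 4 * q / (1 + \<theta>)" using k\<theta> \<theta> by (simp add: field_simps)
    finally have 1: "k * (1 - q) - b * k = (1 - q) * (4 * q / (1 + \<theta>))" .
    have "2 * q \<le> 4 * q / (1 + \<theta>)" using \<theta> q by (simp add: field_simps)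
    hence "(1 - q) * (2 * q) \<le> (1 - q) * (4 * q / (1 + \<theta>))" using q by (intro mult_left_mono) auto
    moreover have "(143 / 144) * (2 * q) \<le> (1 - q) * (2 * q)" using q by (intro mult_right_mono) auto
    moreover have "b * k\<^sup>2 \<le> k\<^sup>2" using b by (simp add: mult_left_le_one_le)
    moreover have "b * (1 + k) * k = b * k + b * k\<^sup>2" by (simp add: algebra_simps power2_eq_square)
    ultimately have "0 \<le> k * (1 - q) - q - b * (1 + k) * k - q / 8" using 1 kk q by linarith
    thus ?thesis using a by simp
  qed
  moreover have "(a' - a) + k * a' = k * (1 - q) * a - q * a + b * (1 + k) * e + (1 + k) * \<rho>"
  proof -
    have "(a' - a) + k * a' = (1 + k) * a' - a" by (simp add: algebra_simps)
    also have "\<dots> = (1 + k) * (a + (b * e - q * a + \<rho>)) - a" using d by simp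
    finally show ?thesis by (simp add: algebra_simps)
  qed
  ultimately have *: "0 \<le> (a' - a) + k * a'" by (simp add: algebra_simps)
  thus "- (2 * q / \<theta> * a') \<le> a' - a" by (simp add: k_def)
  have ak: "a \<le> (1 + k) * a'" using * by (simp add: algebra_simps)
  hence a'0: "0 < a'" using a k by (smt (verit) mult_nonneg_nonpos)
  show "a \<le> 2 * a'" using ak k a'0 mult_right_mono[of "1 + k" 2 a'] by linarith
  have "(1 - k) * a \<le> (1 - k) * ((1 + k) * a')" using ak k by (intro mult_left_mono) auto
  also have "\<dots> = a' - k\<^sup>2 * a'" by (simp add: algebra_simps power2_eq_square)
  also have "\<dots> \<le> a'" using a'0 by simp
  finally show "(1 - 2 * q / \<theta>) * a \<le> a'" by (simp add: k_def)
qed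

context nag_modes_perturbed
begin

text \<open>
  \<open>crit\<close> says \<open>m\<^bsub>T+1\<^esub> \<le> c\<^bsub>T+1\<^esub>\<close>. As long as \<open>\<theta> > 12 / sqrt \<kappa>\<close>, the modes with \<open>q i > 120 / \<kappa>\<close> decay
  faster than the mode \<open>i1\<close>, so after \<open>T\<close> steps \<open>c\<close> is less than \<open>144 m\<close>.
\<close>

lemma slow_phase:
  assumes \<kappa>144: "144 \<le> \<kappa>" and i1: "i1 \<in> I" "q i1 = 1 / \<kappa>" and \<omega>: "0 < \<omega>" "S 0 \<le> \<omega> * (X i1 0)\<^sup>2"
    and X_nz: "X i1 0 \<noteq> 0"
    and h: "h * (16 * \<kappa> ^ 8 * (3 * \<kappa> * \<omega> * 4 ^ (T + 1))) \<le> 1"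
    and T: "(1 - 1 / \<kappa>) ^ T * ((2 + \<kappa>) * \<omega>) \<le> 1 / \<kappa> ^ 5"
    and crit: "(\<theta> (T + 2)) ^ 4 * (\<Sum>i\<in>I. (X i (Suc T) - X i T)\<^sup>2)
      \<le> (\<Sum>i\<in>I. (q i * (X i (Suc T) - X i T) - (r i (Suc T) - r i T))\<^sup>2)"
  shows "\<theta> (T + 2) \<le> 12 / sqrt \<kappa>"
proof (rule ccontr)
  assume "\<not> ?thesis"
  hence \<theta>_big: "12 / sqrt \<kappa> < \<theta> t" if "t \<le> T + 2" for t
    using \<theta>_antimono[OF that] by linarith
  \<comment> \<open>\<open>M\<close> bounds the ratio of \<open>S t\<close> to the squared slow
    coordinate, \<open>P\<close> that of the potential of the stiff modes at the start, and
    \<open>\<zeta>\<close> is the floor the perturbation leaves for the latter ratio.\<close>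
  define M where "M = 3 * \<kappa> * \<omega> * 4 ^ (T + 1)"
  define P where "P = (2 + \<kappa>) * \<omega>"
  define \<zeta> where "\<zeta> = 1 / \<kappa> ^ 5"
  have M0: "0 < M" using \<kappa> \<omega> by (simp add: M_def)
  have hM: "h * M \<le> 1 / (16 * \<kappa> ^ 8)" using h \<kappa> by (simp add: M_def field_simps)
  have hM0: "0 \<le> h * M" using h_nonneg M0 by simp
  have \<theta>_pos: "0 < \<theta> t" if "t \<le> T + 2" for t
    using \<theta>_big[OF that] \<kappa> by (smt (verit) divide_nonneg_nonneg real_sqrt_ge_zero)
  have \<theta>_sq: "144 * (1 / \<kappa>) \<le> (\<theta> t)\<^sup>2" if "t \<le> T + 2" for t
  proof -
    have "(12 / sqrt \<kappa>)\<^sup>2 \<le> (\<theta> t)\<^sup>2" using \<theta>_big[OF that] \<kappa> by (intro power_mono) auto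
    thus ?thesis using \<kappa> by (simp add: power_divide)
  qed
  \<comment> \<open>The sign makes the slow coordinate start positive.\<close>
  define s where "s = sgn (X i1 0)"
  define a e \<rho> where "a t = s * Y i1 t" and "e t = s * D i1 t" and "\<rho> t = s * r i1 t" for t
  have ss: "s * s = 1" using X_nz by (simp add: s_def sgn_if)
  have a_Suc: "a (Suc t) = (1 - 1 / \<kappa>) * (a t + mom (\<theta> t) * e t) + \<rho> t" for t
    by (simp add: a_def e_def \<rho>_def Y_Suc X_eq i1 algebra_simps)
  have e_Suc: "e (Suc t) = a (Suc t) - a t" for t by (simp add: a_def e_def D_Suc algebra_simps)
  have a_0: "a 0 = \<bar>X i1 0\<bar>" by (simp add: a_def s_def X_0 abs_sgn mult.commute)
  have r_R: "(\<rho> t)\<^sup>2 \<le> R t" for t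
  proof -
    have "(\<rho> t)\<^sup>2 = (s * s) * (r i1 t)\<^sup>2" by (simp add: \<rho>_def power2_eq_square)
    also have "\<dots> = (r i1 t)\<^sup>2" using ss by simp
    also have "\<dots> \<le> R t" unfolding R_def using i1 fin by (intro member_le_sum) auto
    finally show ?thesis .
  qed
  \<comment> \<open>The slow coordinate at most halves per step, so \<open>S t\<close> remains
    comparable with its square, with the factor \<open>4 ^ (T + 1)\<close> that the bound on
    \<open>h\<close> compensates.\<close>
  have R_a: "R t \<le> h * M * (a t)\<^sup>2" and \<rho>_a: "\<bar>\<rho> t\<bar> \<le> (1 / \<kappa>) / 16 * a t"
    if "t \<le> T + 1" "0 < a t" "\<bar>X i1 0\<bar> \<le> 2 ^ t * a t" for t
  proof -
    have "(X i1 0)\<^sup>2 \<le> (2 ^ t * a t)\<^sup>2" using that power_mono[OF that(3), of 2] by simp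
    also have "\<dots> = 4 ^ t * (a t)\<^sup>2"
    proof -
      have "((2::real) ^ t)\<^sup>2 = (2\<^sup>2) ^ t" by (metis power_mult mult.commute)
      thus ?thesis by (simp add: power_mult_distrib)
    qed
    also have "\<dots> \<le> 4 ^ (T + 1) * (a t)\<^sup>2" using that by (intro mult_right_mono power_increasing) auto
    finally have "\<omega> * (X i1 0)\<^sup>2 \<le> \<omega> * (4 ^ (T + 1) * (a t)\<^sup>2)" using \<omega> by (intro mult_left_mono) auto
    hence "3 * \<kappa> * S 0 \<le> 3 * \<kappa> * (\<omega> * (4 ^ (T + 1) * (a t)\<^sup>2))"
      using order_trans[OF \<omega>(2)] \<kappa> by (intro mult_left_mono) auto
    also have "\<dots> = M * (a t)\<^sup>2" by (simp add: M_def)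
    finally have "S t \<le> M * (a t)\<^sup>2" using S_le[of t] by linarith
    hence "h * S t \<le> h * (M * (a t)\<^sup>2)" using h_nonneg by (intro mult_left_mono) auto
    thus R: "R t \<le> h * M * (a t)\<^sup>2" using R_le[of t] by (simp add: mult.assoc)
    have "h * M \<le> 1 / (16 * \<kappa> ^ 8)" by (rule hM)
    also have "\<dots> \<le> ((1 / \<kappa>) / 16)\<^sup>2"
    proof -
      have "144 ^ 6 \<le> \<kappa> ^ 6" using \<kappa>144 by (intro power_mono) auto
      hence "\<kappa>\<^sup>2 * 256 \<le> \<kappa>\<^sup>2 * (16 * \<kappa> ^ 6)" by (intro mult_left_mono) auto
      moreover have "\<kappa> ^ 8 = \<kappa>\<^sup>2 * \<kappa> ^ 6" by (simp flip: power_add)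
      ultimately have "\<kappa>\<^sup>2 * 256 \<le> 16 * \<kappa> ^ 8" by linarith
      hence "1 / (16 * \<kappa> ^ 8) \<le> 1 / (\<kappa>\<^sup>2 * 256)" by (rule divide_left_mono) (use \<kappa> in auto)
      thus ?thesis by (simp add: power_divide)
    qed
    finally have "h * M * (a t)\<^sup>2 \<le> ((1 / \<kappa>) / 16)\<^sup>2 * (a t)\<^sup>2" by (intro mult_right_mono) auto
    hence "(\<rho> t)\<^sup>2 \<le> ((1 / \<kappa>) / 16 * a t)\<^sup>2"
      using R r_R[of t] unfolding power_mult_distrib by linarith
    hence "\<bar>\<rho> t\<bar> \<le> \<bar>(1 / \<kappa>) / 16 * a t\<bar>" unfolding abs_le_square_iff .
    thus "\<bar>\<rho> t\<bar> \<le> (1 / \<kappa>) / 16 * a t" using that \<kappa> by simp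
  qed
  have step: "- (2 * (1 / \<kappa>) / \<theta> t * a (Suc t)) \<le> e (Suc t)" "e (Suc t) \<le> - (3 / 4 * (1 / \<kappa>) * a t)"
      "(1 - 2 * (1 / \<kappa>) / \<theta> t) * a t \<le> a (Suc t)" "a t \<le> 2 * a (Suc t)"
    if "t \<le> T + 1" "0 < a t" "e t \<le> 0" "- (2 * (1 / \<kappa>) / \<theta> t * a t) \<le> e t" "\<bar>X i1 0\<bar> \<le> 2 ^ t * a t" for t
  proof -
    have k: "0 < 1 / \<kappa>" "1 / \<kappa> \<le> 1 / 144" using \<kappa>144 by auto
    have t: "t \<le> T + 2" using that(1) by simp
    note sm = slow_mode_step[OF k \<theta>_pos[OF t] \<theta>_le_1 \<theta>_sq[OF t] that(2,3,4) \<rho>_a[OF that(1,2,5)] a_Suc]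
    show "- (2 * (1 / \<kappa>) / \<theta> t * a (Suc t)) \<le> e (Suc t)" "e (Suc t) \<le> - (3 / 4 * (1 / \<kappa>) * a t)"
      "(1 - 2 * (1 / \<kappa>) / \<theta> t) * a t \<le> a (Suc t)" "a t \<le> 2 * a (Suc t)"
      unfolding e_Suc by (fact sm)+
  qed
  have inv: "0 < a t \<and> e t \<le> 0 \<and> - (2 * (1 / \<kappa>) / \<theta> t * a t) \<le> e t \<and> \<bar>X i1 0\<bar> \<le> 2 ^ t * a t"
    if "t \<le> T + 1" for t
    using that
  proof (induction t)
    case 0
    show ?case using a_0 X_nz \<theta>_pos[of 0] \<kappa> by (simp add: e_def D_0)
  next
    case (Suc t)
    hence IH: "0 < a t" "e t \<le> 0" "- (2 * (1 / \<kappa>) / \<theta> t * a t) \<le> e t" "\<bar>X i1 0\<bar> \<le> 2 ^ t * a t"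
      by auto
    note st = step[OF Suc_leD[OF Suc.prems] IH]
    have a': "0 < a (Suc t)" using st(4) IH(1) by simp
    have "0 \<le> 3 / 4 * (1 / \<kappa>) * a t" using IH \<kappa> by simp
    hence "e (Suc t) \<le> 0" using st(2) by linarith
    \<comment> \<open>Smaller damping only widens the admissible interval of ratios, so the
      invariant survives a decrease of \<open>\<theta>\<close>.\<close>
    moreover have "2 * (1 / \<kappa>) / \<theta> t * a (Suc t) \<le> 2 * (1 / \<kappa>) / \<theta> (Suc t) * a (Suc t)"
      using a' \<theta>_Suc[of t] \<theta>_pos[of "Suc t"] \<kappa> Suc.prems
      by (intro mult_right_mono divide_left_mono) (auto intro: mult_pos_pos \<theta>_pos)
    moreover have "2 ^ t * a t \<le> 2 ^ t * (2 * a (Suc t))" using st(4) by (intro mult_left_mono) auto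
    hence "\<bar>X i1 0\<bar> \<le> 2 ^ Suc t * a (Suc t)" using IH(4) unfolding power_Suc by linarith
    ultimately show ?case using a' st(1) by simp
  qed
  have step: "e (Suc t) \<le> - (3 / 4 * (1 / \<kappa>) * a t)" "(1 - 2 * (1 / \<kappa>) / \<theta> t) * a t \<le> a (Suc t)"
      "a t \<le> 2 * a (Suc t)" and R_a: "R t \<le> h * M * (a t)\<^sup>2" and \<rho>_a: "\<bar>\<rho> t\<bar> \<le> (1 / \<kappa>) / 16 * a t"
    if t: "t \<le> T + 1" for t
  proof -
    from inv[OF t] have i: "0 < a t" "e t \<le> 0" "- (2 * (1 / \<kappa>) / \<theta> t * a t) \<le> e t" "\<bar>X i1 0\<bar> \<le> 2 ^ t * a t"
      by blast+
    show "e (Suc t) \<le> - (3 / 4 * (1 / \<kappa>) * a t)" "(1 - 2 * (1 / \<kappa>) / \<theta> t) * a t \<le> a (Suc t)"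
      "a t \<le> 2 * a (Suc t)" by (rule step[OF t i])+
    show "R t \<le> h * M * (a t)\<^sup>2" "\<bar>\<rho> t\<bar> \<le> (1 / \<kappa>) / 16 * a t"
      by (rule R_a[OF t i(1,4)], rule \<rho>_a[OF t i(1,4)])
  qed
  define H where "H = {i \<in> I. 120 / \<kappa> < q i}"
  have H: "H \<subseteq> I" "finite H" using fin by (auto simp: H_def)
  \<comment> \<open>A quarter of the lower bound that the negated claim gives for all dampings up to
    \<open>T + 2\<close>.\<close>
  define c where "c = 3 / sqrt \<kappa>"
  have c: "0 < c" "\<And>t. t \<le> T + 2 \<Longrightarrow> c \<le> \<theta> t / 4"
    using \<kappa> \<theta>_big by (auto simp: c_def less_imp_le)
  define W where "W t = (\<Sum>i\<in>H. potential \<kappa> c (q i) (\<theta> t) (Y i t) (D i t))" for t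
  have qk: "1 / q i \<le> \<kappa>" if "i \<in> I" for i
    using q_lower[OF that] q_pos[OF that] \<kappa> by (simp add: field_simps)
  note pot_assms = c(1) c(2) q_pos q_upper qk \<theta>_le_1
  have W_Suc: "W (Suc t) \<le> (1 - 5 * (1 / \<kappa> / \<theta> t)) * W t + (1 + \<kappa> / 5) * ((2 + \<kappa>) * (2 * R t))"
    if t: "t \<le> T" for t
  proof -
    \<comment> \<open>The rate that \<open>q i > 120 / \<kappa>\<close> permits through
      \<open>\<tau> \<le> q i / (12 * \<theta> t)\<close>. Half of it is
      \<open>5 / (\<kappa> * \<theta> t)\<close>, whereas the square of the slow coordinate loses at
      most \<open>4 / (\<kappa> * \<theta> t)\<close>.\<close>
    define \<tau> where "\<tau> = 10 / (\<kappa> * \<theta> t)"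
    have \<theta>t: "0 < \<theta> t" using \<theta>_pos t by simp
    have \<tau>0: "0 < \<tau>" using \<theta>t \<kappa> by (simp add: \<tau>_def)
    have \<tau>c: "\<tau> \<le> c / 3"
    proof -
      have "10 / (\<kappa> * \<theta> t) \<le> 10 / (\<kappa> * (12 / sqrt \<kappa>))"
        using \<theta>_big[of t] t \<kappa> \<theta>t by (intro divide_left_mono mult_left_mono mult_pos_pos) auto
      also have "\<kappa> * (12 / sqrt \<kappa>) = 12 * (\<kappa> / sqrt \<kappa>)" by simp
      also have "\<kappa> / sqrt \<kappa> = sqrt \<kappa>" using \<kappa> by (simp add: real_div_sqrt)
      also have "10 / (12 * sqrt \<kappa>) \<le> 1 / sqrt \<kappa>" using \<kappa> by (simp add: field_simps)
      finally show ?thesis by (simp add: \<tau>_def c_def)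
    qed
    have rate: "(1 + 2 / \<tau>) \<le> 1 + \<kappa> / 5"
    proof -
      have "2 / \<tau> = \<kappa> * \<theta> t / 5" using \<kappa> \<theta>t by (simp add: \<tau>_def)
      also have "\<dots> \<le> \<kappa> / 5" using \<theta>_le_1[of t] \<kappa> by simp
      finally show ?thesis by simp
    qed
    have "W (Suc t) \<le> (\<Sum>i\<in>H. (1 - \<tau> / 2) * potential \<kappa> c (q i) (\<theta> t) (Y i t) (D i t) +
        (1 + 2 / \<tau>) * ((2 + \<kappa>) * (2 * (r i t)\<^sup>2)))"
      unfolding W_def
    proof (rule sum_mono)
      fix i assume "i \<in> H"
      hence i: "i \<in> I" and iH: "120 / \<kappa> < q i" by (auto simp: H_def)
      have "\<tau> = (120 / \<kappa>) / (12 * \<theta> t)" by (simp add: \<tau>_def)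
      also have "\<dots> \<le> q i / (12 * \<theta> t)" using iH \<theta>t by (intro divide_right_mono) auto
      finally show "potential \<kappa> c (q i) (\<theta> (Suc t)) (Y i (Suc t)) (D i (Suc t))
        \<le> (1 - \<tau> / 2) * potential \<kappa> c (q i) (\<theta> t) (Y i t) (D i t) + (1 + 2 / \<tau>) * ((2 + \<kappa>) * (2 * (r i t)\<^sup>2))"
        unfolding D_Suc using pot_assms i t \<tau>0 \<tau>c \<theta>_Suc[of t]
        by (intro potential_step_perturb) (auto simp: Y_Suc X_eq)
    qed
    also have "\<dots> = (1 - \<tau> / 2) * W t + (1 + 2 / \<tau>) * ((2 + \<kappa>) * (2 * (\<Sum>i\<in>H. (r i t)\<^sup>2)))"
      by (simp add: W_def sum.distrib sum_distrib_left)
    also have "(1 + 2 / \<tau>) * ((2 + \<kappa>) * (2 * (\<Sum>i\<in>H. (r i t)\<^sup>2))) \<le> (1 + \<kappa> / 5) * ((2 + \<kappa>) * (2 * R t))"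
      unfolding R_def using rate \<kappa> H fin
      by (intro mult_mono sum_mono2 mult_nonneg_nonneg sum_nonneg) auto
    also have "1 - \<tau> / 2 = 1 - 5 * (1 / \<kappa> / \<theta> t)" by (simp add: \<tau>_def)
    finally show ?thesis by simp
  qed
  \<comment> \<open>The stiff modes shrink relative to the slow one: with
    \<open>x = 1 / \<kappa> / \<theta> t\<close> one has
    \<open>1 - 5 * x \<le> (1 - x) * (1 - 4 * x)\<close> and \<open>1 / \<kappa> \<le> x\<close>.
    The floor \<open>\<zeta>\<close> is the fixed point for the added error
    \<open>\<zeta> / \<kappa>\<close>.\<close>
  have W_a: "W t \<le> ((1 - 1 / \<kappa>) ^ t * P + \<zeta>) * (a t)\<^sup>2" if "t \<le> T + 1" for t
    using that
  proof (induction t)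
    case 0
    have "W 0 \<le> (\<Sum>i\<in>H. (2 + \<kappa>) * energy (q i) (Y i 0) (D i 0))" unfolding W_def
      by (intro sum_mono potential_upper) (use pot_assms H in auto)
    also have "\<dots> \<le> (\<Sum>i\<in>I. (2 + \<kappa>) * energy (q i) (Y i 0) (D i 0))"
      using H fin \<kappa> q_pos q_upper by (intro sum_mono2) (auto intro!: mult_nonneg_nonneg energy_nonneg intro: less_imp_le)
    also have "\<dots> = (2 + \<kappa>) * \<Phi> 0" by (simp add: \<Phi>_def sum_distrib_left)
    also have "\<dots> \<le> (2 + \<kappa>) * (\<omega> * (X i1 0)\<^sup>2)" using \<Phi>_0 \<omega> \<kappa> by (intro mult_left_mono) auto
    also have "\<dots> = P * (a 0)\<^sup>2" by (simp add: P_def a_0)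
    also have "\<dots> \<le> ((1 - 1 / \<kappa>) ^ 0 * P + \<zeta>) * (a 0)\<^sup>2"
      using \<kappa> by (intro mult_right_mono) (auto simp: \<zeta>_def)
    finally show ?case .
  next
    case (Suc t)
    define B x where "B = (1 - 1 / \<kappa>) ^ t * P + \<zeta>" and "x = 1 / \<kappa> / \<theta> t"
    have t: "t \<le> T" "t \<le> T + 1" using Suc.prems by auto
    have B0: "0 \<le> B" using \<kappa> \<omega> by (auto simp: B_def P_def \<zeta>_def)
    note st = step[OF t(2)]
    have x: "1 / \<kappa> \<le> x" "x \<le> 1 / 144"
    proof -
      have "(1 / \<kappa>) * 1 \<le> (1 / \<kappa>) * (1 / \<theta> t)" using \<theta>_le_1[of t] \<theta>_pos[of t] t \<kappa>
        by (intro mult_left_mono) auto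
      thus "1 / \<kappa> \<le> x" by (simp add: x_def)
      have "144 * (1 / \<kappa>) \<le> \<theta> t * \<theta> t" using \<theta>_sq[of t] t by (simp add: power2_eq_square)
      also have "\<dots> \<le> \<theta> t" using \<theta>_le_1[of t] \<theta>_nonneg[of t] by (simp add: mult_left_le_one_le)
      finally show "x \<le> 1 / 144" using \<theta>_pos[of t] t \<kappa> by (simp add: x_def field_simps)
    qed
    have a': "(1 - 4 * x) * (a t)\<^sup>2 \<le> (a (Suc t))\<^sup>2"
    proof -
      have "(1 - 4 * x) \<le> (1 - 2 * x)\<^sup>2" by (simp add: power2_eq_square algebra_simps)
      hence "(1 - 4 * x) * (a t)\<^sup>2 \<le> (1 - 2 * x)\<^sup>2 * (a t)\<^sup>2" by (intro mult_right_mono) auto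
      also have "\<dots> = ((1 - 2 * x) * a t)\<^sup>2" by (simp add: power_mult_distrib)
      also have "\<dots> \<le> (a (Suc t))\<^sup>2"
        using st(2) x inv[OF t(2)] by (intro power_mono) (auto simp: x_def)
      finally show ?thesis .
    qed
    have a2: "(a t)\<^sup>2 \<le> 4 * (a (Suc t))\<^sup>2"
      using power_mono[OF st(3), of 2] inv[OF t(2)] by (simp add: power_mult_distrib)
    have 1: "(1 - 5 * x) * W t \<le> (1 - 1 / \<kappa>) * B * (a (Suc t))\<^sup>2"
    proof -
      have "(1 - 5 * x) * W t \<le> (1 - 5 * x) * (B * (a t)\<^sup>2)"
        using Suc.IH t x by (intro mult_left_mono) (auto simp: B_def)
      also have "\<dots> \<le> ((1 - x) * (1 - 4 * x)) * (B * (a t)\<^sup>2)"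
        using B0 x by (intro mult_right_mono) (auto simp: algebra_simps)
      also have "\<dots> = ((1 - x) * B) * ((1 - 4 * x) * (a t)\<^sup>2)" by simp
      also have "\<dots> \<le> ((1 - 1 / \<kappa>) * B) * (a (Suc t))\<^sup>2"
        using a' B0 x by (intro mult_mono mult_right_mono) auto
      finally show ?thesis .
    qed
    have 2: "(1 + \<kappa> / 5) * ((2 + \<kappa>) * (2 * R t)) \<le> \<zeta> / \<kappa> * (a (Suc t))\<^sup>2"
    proof -
      have "R t \<le> 1 / (16 * \<kappa> ^ 8) * (4 * (a (Suc t))\<^sup>2)"
        using R_a[OF t(2)] mult_mono[OF hM a2] \<kappa> by simp
      hence "2 * R t \<le> (a (Suc t))\<^sup>2 / (2 * \<kappa> ^ 8)" by simp
      hence "(1 + \<kappa> / 5) * ((2 + \<kappa>) * (2 * R t)) \<le> \<kappa> * ((2 * \<kappa>) * ((a (Suc t))\<^sup>2 / (2 * \<kappa> ^ 8)))"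
        using \<kappa> R_nonneg[of t] by (intro mult_mono) auto
      also have "\<dots> = \<zeta> / \<kappa> * (a (Suc t))\<^sup>2" using \<kappa>
        by (simp add: \<zeta>_def field_simps power2_eq_square eval_nat_numeral)
      finally show ?thesis .
    qed
    have "W (Suc t) \<le> (1 - 1 / \<kappa>) * B * (a (Suc t))\<^sup>2 + \<zeta> / \<kappa> * (a (Suc t))\<^sup>2"
      using W_Suc[OF t(1)] 1 2 unfolding x_def by linarith
    also have "\<dots> = ((1 - 1 / \<kappa>) ^ Suc t * P + \<zeta>) * (a (Suc t))\<^sup>2"
      by (simp add: B_def algebra_simps)
    finally show ?case .
  qed
  have W_small: "W t \<le> 2 * \<zeta> * (a t)\<^sup>2" if "T \<le> t" "t \<le> T + 1" for t
  proof -
    have "(1 - 1 / \<kappa>) ^ t * P \<le> (1 - 1 / \<kappa>) ^ T * P"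
      using \<kappa> \<omega> that by (intro mult_right_mono power_decreasing) (auto simp: P_def)
    also have "\<dots> \<le> \<zeta>" using T by (simp add: P_def \<zeta>_def)
    finally have "((1 - 1 / \<kappa>) ^ t * P + \<zeta>) * (a t)\<^sup>2 \<le> 2 * \<zeta> * (a t)\<^sup>2" by (intro mult_right_mono) auto
    thus ?thesis using W_a[OF that(2)] by simp
  qed
  have X_high: "(\<Sum>i\<in>H. (X i t)\<^sup>2) \<le> 18 / \<kappa> ^ 4 * (a t)\<^sup>2" if t: "T \<le> t" "t \<le> T + 1" for t
  proof -
    have "(\<Sum>i\<in>H. (X i t)\<^sup>2) \<le> (\<Sum>i\<in>H. 9 * \<kappa> * potential \<kappa> c (q i) (\<theta> t) (Y i t) (D i t))"
    proof (rule sum_mono)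
      fix i assume "i \<in> H"
      hence i: "i \<in> I" using H by auto
      have "energy (q i) (Y i t) (D i t) / 3 \<le> potential \<kappa> c (q i) (\<theta> t) (Y i t) (D i t)"
        by (intro potential_lower) (use pot_assms i t in auto)
      hence "9 * \<kappa> * (energy (q i) (Y i t) (D i t) / 3) \<le> 9 * \<kappa> * potential \<kappa> c (q i) (\<theta> t) (Y i t) (D i t)"
        using \<kappa> by (intro mult_left_mono) auto
      thus "(X i t)\<^sup>2 \<le> 9 * \<kappa> * potential \<kappa> c (q i) (\<theta> t) (Y i t) (D i t)" using X_le_energy[OF i, of t] by simp
    qed
    also have "\<dots> = 9 * \<kappa> * W t" by (simp add: W_def sum_distrib_left)
    also have "\<dots> \<le> 9 * \<kappa> * (2 * \<zeta> * (a t)\<^sup>2)" using W_small[OF t] \<kappa> by (intro mult_left_mono) auto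
    also have "\<dots> = 18 / \<kappa> ^ 4 * (a t)\<^sup>2" using \<kappa> by (simp add: \<zeta>_def field_simps eval_nat_numeral)
    finally show ?thesis .
  qed
  define A where "A = a (Suc T)"
  have A0: "0 < A" using inv[of "Suc T"] by (simp add: A_def)
  have aT: "0 < a T" "a T \<le> 2 * A" using inv[of T] step(3)[of T] by (auto simp: A_def)
  hence aT2: "(a T)\<^sup>2 \<le> 4 * A\<^sup>2" using power_mono[OF aT(2), of 2] by (simp add: power_mult_distrib)
  \<comment> \<open>The gradient difference divided by \<open>L0\<close> has coordinates
    \<open>q i * \<Delta> i - \<delta> i\<close>, with \<open>\<delta>\<close> the nonlinear
    share.\<close>
  define \<Delta> \<delta> where "\<Delta> i = X i (Suc T) - X i T" and "\<delta> i = r i (Suc T) - r i T" for i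
  have sq_diff: "(x - y)\<^sup>2 \<le> 2 * x\<^sup>2 + 2 * y\<^sup>2" for x y :: real
    using zero_le_power2[of "x + y"] by (simp add: power2_eq_square algebra_simps)
  have \<Delta>_high: "(\<Sum>i\<in>H. (\<Delta> i)\<^sup>2) \<le> 180 / \<kappa> ^ 4 * A\<^sup>2"
  proof -
    have "(\<Sum>i\<in>H. (\<Delta> i)\<^sup>2) \<le> (\<Sum>i\<in>H. 2 * (X i (Suc T))\<^sup>2 + 2 * (X i T)\<^sup>2)"
      unfolding \<Delta>_def by (intro sum_mono sq_diff)
    also have "\<dots> = 2 * (\<Sum>i\<in>H. (X i (Suc T))\<^sup>2) + 2 * (\<Sum>i\<in>H. (X i T)\<^sup>2)"
      by (simp add: sum.distrib sum_distrib_left)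
    also have "\<dots> \<le> 2 * (18 / \<kappa> ^ 4 * A\<^sup>2) + 2 * (18 / \<kappa> ^ 4 * (a T)\<^sup>2)"
      using X_high[of "Suc T"] X_high[of T] by (simp add: A_def)
    also have "\<dots> \<le> 2 * (18 / \<kappa> ^ 4 * A\<^sup>2) + 2 * (18 / \<kappa> ^ 4 * (4 * A\<^sup>2))"
      using aT2 \<kappa> by (intro add_left_mono mult_left_mono) auto
    also have "\<dots> = 180 / \<kappa> ^ 4 * A\<^sup>2" by simp
    finally show ?thesis .
  qed
  have \<delta>_small: "(\<Sum>i\<in>I. (\<delta> i)\<^sup>2) \<le> 10 / \<kappa> ^ 4 * A\<^sup>2"
  proof -
    have hM4: "h * M \<le> 1 / \<kappa> ^ 4"
    proof -
      have "1 * \<kappa> ^ 4 \<le> (16 * \<kappa> ^ 4) * \<kappa> ^ 4"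
        using \<kappa> by (intro mult_right_mono) (auto intro: order_trans[of 1 "\<kappa> ^ 4"])
      moreover have "\<kappa> ^ 8 = \<kappa> ^ 4 * \<kappa> ^ 4" by (simp flip: power_add)
      ultimately have "\<kappa> ^ 4 \<le> 16 * \<kappa> ^ 8" by linarith
      hence "1 / (16 * \<kappa> ^ 8) \<le> 1 / \<kappa> ^ 4" by (rule divide_left_mono) (use \<kappa> in auto)
      thus ?thesis using hM by simp
    qed
    have "(\<Sum>i\<in>I. (\<delta> i)\<^sup>2) \<le> (\<Sum>i\<in>I. 2 * (r i (Suc T))\<^sup>2 + 2 * (r i T)\<^sup>2)"
      unfolding \<delta>_def by (intro sum_mono sq_diff)
    also have "\<dots> = 2 * R (Suc T) + 2 * R T" by (simp add: R_def sum.distrib sum_distrib_left)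
    also have "\<dots> \<le> 2 * (h * M * A\<^sup>2) + 2 * (h * M * (a T)\<^sup>2)"
      using R_a[of "Suc T"] R_a[of T] by (simp add: A_def)
    also have "\<dots> \<le> 2 * (h * M * A\<^sup>2) + 2 * (h * M * (4 * A\<^sup>2))"
      using aT2 hM0 by (intro add_left_mono mult_left_mono) auto
    also have "\<dots> = 10 * (h * M * A\<^sup>2)" by simp
    also have "\<dots> \<le> 10 * (1 / \<kappa> ^ 4 * A\<^sup>2)" using hM4 by (intro mult_left_mono mult_right_mono) auto
    finally show ?thesis by simp
  qed
  have \<Delta>_low: "A\<^sup>2 / (4 * \<kappa>\<^sup>2) \<le> (\<Sum>i\<in>I. (\<Delta> i)\<^sup>2)"
  proof -
    \<comment> \<open>Up to \<open>r\<close>, the next \<open>Y\<close> is a multiple of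
      \<open>X\<close>; so the displacement of \<open>X\<close> from \<open>T\<close> to
      \<open>T + 1\<close> is read off the increment of \<open>Y\<close> at index
      \<open>T + 2\<close>, whose size is bounded below.\<close>
    have "(1 - 1 / \<kappa>) * X i1 t = Y i1 (Suc t) - r i1 t" for t by (simp add: Y_Suc i1)
    hence "(1 - 1 / \<kappa>) * \<Delta> i1 = D i1 (Suc (Suc T)) - r i1 (Suc T) + r i1 T"
      by (simp add: \<Delta>_def D_Suc right_diff_distrib)
    hence "(1 - 1 / \<kappa>) * (s * \<Delta> i1) = e (Suc (Suc T)) - \<rho> (Suc T) + \<rho> T"
      unfolding e_def \<rho>_def by (metis mult.left_commute right_diff_distrib distrib_left)
    also have "\<dots> \<le> - (3 / 4 * (1 / \<kappa>) * A) + (1 / \<kappa>) / 16 * A + (1 / \<kappa>) / 16 * (2 * A)"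
    proof -
      have "(1 / \<kappa>) / 16 * a T \<le> (1 / \<kappa>) / 16 * (2 * A)" using aT \<kappa> by (intro mult_left_mono) auto
      thus ?thesis using step(1)[of "Suc T"] \<rho>_a[of "Suc T"] \<rho>_a[of T] by (simp add: A_def)
    qed
    also have "\<dots> \<le> - ((1 / \<kappa>) / 2 * A)" using A0 \<kappa> by (simp add: field_simps)
    finally have 1: "(1 / \<kappa>) / 2 * A \<le> (1 - 1 / \<kappa>) * (- (s * \<Delta> i1))" by simp
    define z where "z = - (s * \<Delta> i1)"
    have "0 \<le> (1 / \<kappa>) / 2 * A" using A0 \<kappa> by simp
    with 1 have "0 \<le> (1 - 1 / \<kappa>) * z" unfolding z_def by linarith
    moreover have k1: "0 < 1 - 1 / \<kappa>" using \<kappa> by simp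
    ultimately have "0 \<le> z" by (metis zero_le_mult_iff not_less)
    hence "(1 - 1 / \<kappa>) * z \<le> 1 * z" using \<kappa> by (intro mult_right_mono) auto
    with 1 have "(1 / \<kappa>) / 2 * A \<le> z" unfolding z_def by linarith
    hence "((1 / \<kappa>) / 2 * A)\<^sup>2 \<le> z\<^sup>2" using A0 \<kappa> by (intro power_mono) auto
    also have "z\<^sup>2 = (s * s) * (\<Delta> i1)\<^sup>2" by (simp add: z_def power2_eq_square)
    also have "\<dots> = (\<Delta> i1)\<^sup>2" using ss by simp
    also have "\<dots> \<le> (\<Sum>i\<in>I. (\<Delta> i)\<^sup>2)" using i1 fin by (intro member_le_sum) auto
    finally show ?thesis by (simp add: power_mult_distrib power_divide)
  qed
  define N where "N = (\<Sum>i\<in>I. (\<Delta> i)\<^sup>2)"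
  have "20736 / \<kappa>\<^sup>2 * N \<le> (\<theta> (T + 2)) ^ 4 * N"
  proof (rule mult_right_mono)
    have "(144 * (1 / \<kappa>))\<^sup>2 \<le> ((\<theta> (T + 2))\<^sup>2)\<^sup>2" using \<theta>_sq[of "T + 2"] \<kappa> by (intro power_mono) auto
    thus "20736 / \<kappa>\<^sup>2 \<le> (\<theta> (T + 2)) ^ 4" by (simp add: power_divide)
  qed (auto simp: N_def intro: sum_nonneg)
  also have "\<dots> \<le> (\<Sum>i\<in>I. (q i * \<Delta> i - \<delta> i)\<^sup>2)" using crit by (simp add: N_def \<Delta>_def \<delta>_def)
  \<comment> \<open>The Young factor 6/5 keeps the modes outside \<open>H\<close> at
    \<open>6 / 5 * 120\<^sup>2 = 17280\<close>, below \<open>144\<^sup>2 = 20736\<close>. The stiff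
    modes and the nonlinear part are too small to fill the gap 3456.\<close>
  also have "\<dots> \<le> (\<Sum>i\<in>I. 17280 / \<kappa>\<^sup>2 * (\<Delta> i)\<^sup>2 + 6 * (\<delta> i)\<^sup>2 + (if i \<in> H then 2 * (\<Delta> i)\<^sup>2 else 0))"
  proof (rule sum_mono)
    fix i assume i: "i \<in> I"
    show "(q i * \<Delta> i - \<delta> i)\<^sup>2 \<le> 17280 / \<kappa>\<^sup>2 * (\<Delta> i)\<^sup>2 + 6 * (\<delta> i)\<^sup>2 + (if i \<in> H then 2 * (\<Delta> i)\<^sup>2 else 0)"
    proof (cases "i \<in> H")
      case True
      have "(q i * \<Delta> i - \<delta> i)\<^sup>2 \<le> 2 * (q i * \<Delta> i)\<^sup>2 + 2 * (\<delta> i)\<^sup>2" by (rule sq_diff)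
      moreover have "(q i * \<Delta> i)\<^sup>2 \<le> (\<Delta> i)\<^sup>2"
        using q_pos[OF i] q_upper[OF i] by (simp add: power_mult_distrib mult_left_le_one_le power_le_one)
      moreover have "0 \<le> 17280 / \<kappa>\<^sup>2 * (\<Delta> i)\<^sup>2 + 4 * (\<delta> i)\<^sup>2" by simp
      ultimately have "(q i * \<Delta> i - \<delta> i)\<^sup>2 \<le> 17280 / \<kappa>\<^sup>2 * (\<Delta> i)\<^sup>2 + 6 * (\<delta> i)\<^sup>2 + 2 * (\<Delta> i)\<^sup>2"
        by linarith
      thus ?thesis using True by simp
    next
      case False
      hence "q i \<le> 120 / \<kappa>" using i by (simp add: H_def)
      hence "(q i)\<^sup>2 \<le> (120 / \<kappa>)\<^sup>2" using q_pos[OF i] by (intro power_mono) auto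
      hence qi: "6 / 5 * ((q i)\<^sup>2 * (\<Delta> i)\<^sup>2) \<le> 6 / 5 * ((120 / \<kappa>)\<^sup>2 * (\<Delta> i)\<^sup>2)"
        by (intro mult_left_mono mult_right_mono) auto
      have "(x - y)\<^sup>2 \<le> 6 / 5 * x\<^sup>2 + 6 * y\<^sup>2" for x y :: real
      proof -
        have "6 / 5 * x\<^sup>2 + 6 * y\<^sup>2 - (x - y)\<^sup>2 = 1 / 5 * (x + 5 * y)\<^sup>2"
          by (simp add: power2_eq_square algebra_simps)
        thus ?thesis using zero_le_power2[of "x + 5 * y"] by linarith
      qed
      from this[of "q i * \<Delta> i" "\<delta> i"] qi False show ?thesis
        by (simp add: power_mult_distrib power_divide)
    qed
  qed
  also have "\<dots> = 17280 / \<kappa>\<^sup>2 * N + 6 * (\<Sum>i\<in>I. (\<delta> i)\<^sup>2) + 2 * (\<Sum>i\<in>H. (\<Delta> i)\<^sup>2)"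
  proof -
    have "(\<Sum>i\<in>I. if i \<in> H then 2 * (\<Delta> i)\<^sup>2 else 0) = (\<Sum>i\<in>H. 2 * (\<Delta> i)\<^sup>2)"
      using H fin by (subst sum.inter_restrict[symmetric]) (auto simp: Int_absorb1)
    thus ?thesis by (simp add: N_def sum.distrib sum_distrib_left)
  qed
  also have "\<dots> \<le> 17280 / \<kappa>\<^sup>2 * N + 420 / \<kappa> ^ 4 * A\<^sup>2"
    using \<Delta>_high \<delta>_small by simp
  finally have 1: "3456 / \<kappa>\<^sup>2 * N \<le> 420 / \<kappa> ^ 4 * A\<^sup>2" by linarith
  have "3456 / \<kappa>\<^sup>2 * (A\<^sup>2 / (4 * \<kappa>\<^sup>2)) \<le> 3456 / \<kappa>\<^sup>2 * N"
    using \<Delta>_low by (intro mult_left_mono) (auto simp: N_def)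
  also have "\<dots> \<le> 420 / \<kappa> ^ 4 * A\<^sup>2" by (rule 1)
  also have "3456 / \<kappa>\<^sup>2 * (A\<^sup>2 / (4 * \<kappa>\<^sup>2)) = 864 / \<kappa> ^ 4 * A\<^sup>2"
    using \<kappa> by (simp add: field_simps flip: power_add)
  finally have "864 * (A\<^sup>2 / \<kappa> ^ 4) \<le> 420 * (A\<^sup>2 / \<kappa> ^ 4)" by simp
  moreover have "0 < A\<^sup>2 / \<kappa> ^ 4" using A0 \<kappa> by simp
  ultimately show False by linarith
qed

end

section \<open>The rate for families of modes\<close>

lemma power_power2_swap: "((x::real) ^ n)\<^sup>2 = (x\<^sup>2) ^ n"
  by (metis power_mult mult.commute)

text \<open>
  The constant must not depend on \<open>\<gamma>\<close>, whereas the admissible relative size \<open>h\<close> of the perturbation may.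
\<close>

definition modes_rate :: "real \<Rightarrow> real \<Rightarrow> real \<Rightarrow> real \<Rightarrow> real \<Rightarrow> bool" where
  "modes_rate \<kappa> \<omega> \<gamma> C h \<longleftrightarrow>
     (\<forall>I q X Y D r \<theta> i1 N. nag_modes_perturbed I q X Y D r \<theta> \<kappa> h \<longrightarrow>
          i1 \<in> I \<longrightarrow> q i1 = 1 / \<kappa> \<longrightarrow> (\<Sum>i\<in>I. (X i 0)\<^sup>2) \<le> \<omega> * (X i1 0)\<^sup>2 \<longrightarrow>
          (\<forall>t. (\<theta> (t + 2)) ^ 4 * (\<Sum>i\<in>I. (X i (Suc t) - X i t)\<^sup>2)
             \<le> (\<Sum>i\<in>I. (q i * (X i (Suc t) - X i t) - (r i (Suc t) - r i t))\<^sup>2)) \<longrightarrow>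
          (\<forall>t\<le>N. 1 / sqrt (\<gamma> * \<kappa>) \<le> \<theta> t) \<longrightarrow>
          (\<Sum>i\<in>I. (X i N)\<^sup>2) \<le> (C * (1 - 1 / (1152 * sqrt (\<gamma> * \<kappa>))) ^ N)\<^sup>2 * (\<Sum>i\<in>I. (X i 0)\<^sup>2))"

definition modes_constant :: "real \<Rightarrow> real \<Rightarrow> real \<Rightarrow> bool" where
  "modes_constant \<kappa> \<omega> C \<longleftrightarrow> 0 < C \<and>
     (\<forall>\<gamma>>1. \<exists>h>0. h * (48 * \<kappa>\<^sup>2 * (1 + 4 * \<kappa>)) \<le> 1 \<and> modes_rate \<kappa> \<omega> \<gamma> C h)"

lemma modes_rateD:
  assumes "modes_rate \<kappa> \<omega> \<gamma> C h" "nag_modes_perturbed I q X Y D r \<theta> \<kappa> h" "i1 \<in> I" "q i1 = 1 / \<kappa>"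
    "(\<Sum>i\<in>I. (X i 0)\<^sup>2) \<le> \<omega> * (X i1 0)\<^sup>2"
    "\<And>t. (\<theta> (t + 2)) ^ 4 * (\<Sum>i\<in>I. (X i (Suc t) - X i t)\<^sup>2)
       \<le> (\<Sum>i\<in>I. (q i * (X i (Suc t) - X i t) - (r i (Suc t) - r i t))\<^sup>2)"
    "\<And>t. t \<le> N \<Longrightarrow> 1 / sqrt (\<gamma> * \<kappa>) \<le> \<theta> t"
  shows "(\<Sum>i\<in>I. (X i N)\<^sup>2) \<le> (C * (1 - 1 / (1152 * sqrt (\<gamma> * \<kappa>))) ^ N)\<^sup>2 * (\<Sum>i\<in>I. (X i 0)\<^sup>2)"
  by (rule assms(1)[unfolded modes_rate_def, rule_format, OF assms(2-)])

text \<open>\<open>T\<close> is fixed from \<open>\<kappa>\<close> and \<open>\<omega>\<close>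
  alone. For large \<open>\<kappa>\<close> the first \<open>T + 2\<close> steps are only bounded and
  enter \<open>C\<close> as \<open>2 ^ (T + 2)\<close>, which suffices since the rate
  \<open>\<beta>\<close> is at least 1/2; afterwards \<open>slow_phase\<close> supplies the damping
  bound for \<open>fast_phase\<close>.\<close>

lemma modes_constant_exists:
  assumes \<kappa>: "4 \<le> \<kappa>" and \<omega>: "0 < \<omega>"
  shows "\<exists>C. modes_constant \<kappa> \<omega> C"
proof -
  have "\<exists>T. (1 - 1 / \<kappa>) ^ T < 1 / (\<kappa> ^ 5 * ((2 + \<kappa>) * \<omega>))"
    using \<kappa> \<omega> by (intro real_arch_pow_inv) auto
  then obtain T where T: "(1 - 1 / \<kappa>) ^ T < 1 / (\<kappa> ^ 5 * ((2 + \<kappa>) * \<omega>))" by blast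
  have T': "(1 - 1 / \<kappa>) ^ T * ((2 + \<kappa>) * \<omega>) \<le> 1 / \<kappa> ^ 5"
  proof -
    have "(1 - 1 / \<kappa>) ^ T * ((2 + \<kappa>) * \<omega>) \<le> 1 / (\<kappa> ^ 5 * ((2 + \<kappa>) * \<omega>)) * ((2 + \<kappa>) * \<omega>)"
      using T \<kappa> \<omega> by (intro mult_right_mono) auto
    thus ?thesis using \<kappa> \<omega> by simp
  qed
  define C where "C = 9 * \<kappa> * (2 + \<kappa>) * 2 ^ (T + 2)"
  have C2: "9 * \<kappa> * (2 + \<kappa>) * 4 ^ (T + 2) \<le> C\<^sup>2"
  proof -
    have "1 * 1 \<le> (9 * \<kappa>) * (2 + \<kappa>)" using \<kappa> by (intro mult_mono) auto
    hence "(9 * \<kappa> * (2 + \<kappa>)) * 1 \<le> (9 * \<kappa> * (2 + \<kappa>)) * (9 * \<kappa> * (2 + \<kappa>))"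
      using \<kappa> by (intro mult_left_mono) auto
    hence "9 * \<kappa> * (2 + \<kappa>) * 4 ^ (T + 2) \<le> (9 * \<kappa> * (2 + \<kappa>))\<^sup>2 * 4 ^ (T + 2)"
      unfolding power2_eq_square by (intro mult_right_mono) auto
    also have "\<dots> = C\<^sup>2" unfolding C_def power_mult_distrib power_power2_swap by simp
    finally show ?thesis .
  qed
  have C1: "3 * \<kappa> * 4 ^ (T + 2) \<le> C\<^sup>2"
  proof -
    have "3 * \<kappa> \<le> 9 * \<kappa> * (2 + \<kappa>)" using \<kappa> mult_mono[of 3 "9 * (2 + \<kappa>)" \<kappa> \<kappa>] by (simp add: mult_ac)
    hence "3 * \<kappa> * 4 ^ (T + 2) \<le> 9 * \<kappa> * (2 + \<kappa>) * 4 ^ (T + 2)" by (intro mult_right_mono) auto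
    thus ?thesis using C2 by linarith
  qed
  show ?thesis
    unfolding modes_constant_def
  proof (rule exI[of _ C], intro conjI allI impI)
    show "0 < C" using \<kappa> by (simp add: C_def)
    fix \<gamma> :: real assume \<gamma>: "1 < \<gamma>"
    define g where "g = sqrt (\<gamma> * \<kappa>)"
    have g2: "2 \<le> g"
    proof -
      have "1 * 4 \<le> \<gamma> * \<kappa>" using \<gamma> \<kappa> by (intro mult_mono) auto
      hence "sqrt 4 \<le> g" unfolding g_def by (intro real_sqrt_le_mono) auto
      thus ?thesis by simp
    qed
    have gk: "sqrt \<kappa> \<le> g" unfolding g_def using \<gamma> \<kappa> by (intro real_sqrt_le_mono) auto
    \<comment> \<open>Satisfies both bounds of \<open>fast_phase\<close>:
      \<open>1 / (12 * \<kappa> * B)\<close> is \<open>1 / (144 * sqrt \<kappa>)\<close> for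
      \<open>B = 12 / sqrt \<kappa>\<close>, and \<open>c / 3\<close> is
      \<open>1 / (12 * g)\<close>.\<close>
    define \<tau> where "\<tau> = 1 / (144 * g)"
    \<comment> \<open>The sum of the three factors that limit \<open>h\<close>, so that
      \<open>1 / A\<close> meets all limits at once.\<close>
    define A where "A = 48 * \<kappa>\<^sup>2 * (1 + 4 * \<kappa>) + 72 * \<kappa> * (2 + \<kappa>) * (1 + 2 / \<tau>) / \<tau>
      + 16 * \<kappa> ^ 8 * (3 * \<kappa> * \<omega> * 4 ^ (T + 1))"
    have \<tau>0: "0 < \<tau>" using g2 by (simp add: \<tau>_def)
    have A0: "0 \<le> 48 * \<kappa>\<^sup>2 * (1 + 4 * \<kappa>)" "0 \<le> 72 * \<kappa> * (2 + \<kappa>) * (1 + 2 / \<tau>) / \<tau>"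
      "0 < 16 * \<kappa> ^ 8 * (3 * \<kappa> * \<omega> * 4 ^ (T + 1))"
      using \<kappa> \<omega> \<tau>0 by auto
    define h where "h = 1 / A"
    have Apos: "0 < A" using A0 unfolding A_def by linarith
    have h0: "0 < h" and hA: "h * A = 1" using Apos by (auto simp: h_def)
    have h_le: "h * x \<le> 1" if "x \<le> A" for x using mult_left_mono[OF that, of h] h0 hA by simp
    have h1: "h * (48 * \<kappa>\<^sup>2 * (1 + 4 * \<kappa>)) \<le> 1" and
      h2: "h * (72 * \<kappa> * (2 + \<kappa>) * (1 + 2 / \<tau>) / \<tau>) \<le> 1" and
      h3: "h * (16 * \<kappa> ^ 8 * (3 * \<kappa> * \<omega> * 4 ^ (T + 1))) \<le> 1"
      using A0 by (intro h_le; simp add: A_def)+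
    have h2': "h * (72 * \<kappa> * (2 + \<kappa>) * (1 + 2 / \<tau>)) \<le> \<tau>" using h2 \<tau>0 by (simp add: field_simps)
    \<comment> \<open>Rate for norms: \<open>\<tau> / 4\<close> is the rate for squares, and
      \<open>1152 = 2 * 4 * 144\<close>.\<close>
    define \<beta> where "\<beta> = 1 - 1 / (1152 * g)"
    have \<beta>: "1 / 2 \<le> \<beta>" "\<beta> \<le> 1" using g2 by (auto simp: \<beta>_def field_simps)
    have \<beta>2: "1 - \<tau> / 4 \<le> \<beta>\<^sup>2"
    proof -
      have "\<tau> / 4 = 2 * (1 / (1152 * g))" by (simp add: \<tau>_def)
      moreover have "1 - 2 * x \<le> (1 - x)\<^sup>2" for x :: real by (simp add: power2_eq_square algebra_simps)
      ultimately show ?thesis unfolding \<beta>_def by metis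
    qed
    have \<tau>1: "\<tau> \<le> 1" using g2 by (simp add: \<tau>_def field_simps)
    show "\<exists>h>0. h * (48 * \<kappa>\<^sup>2 * (1 + 4 * \<kappa>)) \<le> 1 \<and> modes_rate \<kappa> \<omega> \<gamma> C h"
      unfolding modes_rate_def
    proof (intro exI[of _ h] conjI h0 h1 allI impI)
      fix I q X Y D r \<theta> i1 N
      assume "nag_modes_perturbed I q X Y D r \<theta> \<kappa> h"
      then interpret nag_modes_perturbed I q X Y D r \<theta> \<kappa> h .
      assume i1: "i1 \<in> I" "q i1 = 1 / \<kappa>" and om: "(\<Sum>i\<in>I. (X i 0)\<^sup>2) \<le> \<omega> * (X i1 0)\<^sup>2"
        and crit: "\<forall>t. (\<theta> (t + 2)) ^ 4 * (\<Sum>i\<in>I. (X i (Suc t) - X i t)\<^sup>2)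
             \<le> (\<Sum>i\<in>I. (q i * (X i (Suc t) - X i t) - (r i (Suc t) - r i t))\<^sup>2)"
        and \<theta>N: "\<forall>t\<le>N. 1 / sqrt (\<gamma> * \<kappa>) \<le> \<theta> t"
      have "S N \<le> C\<^sup>2 * (\<beta>\<^sup>2) ^ N * S 0"
      proof (cases "X i1 0 = 0")
        case True
        hence "S 0 = 0" using om S_nonneg[of 0] by (simp add: S_def)
        thus ?thesis using S_le[of N] by simp
      next
        case X_nz: False
        show ?thesis
        proof (cases "\<kappa> \<le> 1296")
          case True
          \<comment> \<open>For bounded \<open>\<kappa>\<close> the rates
            \<open>1 / \<kappa>\<close> and \<open>1 / sqrt \<kappa>\<close> differ by a constant
            only: \<open>\<kappa> \<le> 36 * g\<close>.\<close>
          have "sqrt \<kappa> \<le> sqrt (36\<^sup>2)" using True by (intro real_sqrt_le_mono) auto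
          hence "sqrt \<kappa> * sqrt \<kappa> \<le> 36 * g" using gk \<kappa> by (intro mult_mono) auto
          hence "8 * \<kappa> \<le> 576 * g" using \<kappa> g2 by simp
          hence "1 / (576 * g) \<le> 1 / (8 * \<kappa>)" using \<kappa> g2 by (intro divide_left_mono) auto
          hence "1 - 1 / (8 * \<kappa>) \<le> 1 - \<tau> / 4" by (simp add: \<tau>_def)
          hence "1 - 1 / (8 * \<kappa>) \<le> \<beta>\<^sup>2" using \<beta>2 by simp
          hence "(1 - 1 / (8 * \<kappa>)) ^ N \<le> (\<beta>\<^sup>2) ^ N" using \<kappa> by (intro power_mono) auto
          hence "3 * \<kappa> * ((1 - 1 / (8 * \<kappa>)) ^ N * S 0) \<le> (3 * \<kappa> * 1) * ((\<beta>\<^sup>2) ^ N * S 0)"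
            using \<kappa> S_nonneg[of 0] by (simp add: mult_right_mono)
          also have "\<dots> \<le> (3 * \<kappa> * 4 ^ (T + 2)) * ((\<beta>\<^sup>2) ^ N * S 0)"
            using \<kappa> S_nonneg[of 0] by (intro mult_right_mono mult_left_mono one_le_power) auto
          also have "\<dots> \<le> C\<^sup>2 * ((\<beta>\<^sup>2) ^ N * S 0)"
            using C1 S_nonneg[of 0] by (intro mult_right_mono) auto
          finally show ?thesis using S_decay_power[of N] by (simp add: mult.assoc)
        next
          case False
          hence \<kappa>_big: "1296 \<le> \<kappa>" by simp
          have quarter: "1 \<le> 4 ^ n * (\<beta>\<^sup>2) ^ n" for n
          proof -
            have "(1 / 2)\<^sup>2 \<le> \<beta>\<^sup>2" using \<beta> by (intro power_mono) auto
            hence "1 \<le> 4 * \<beta>\<^sup>2" by (simp add: power_divide)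
            hence "1 \<le> (4 * \<beta>\<^sup>2) ^ n" by (rule one_le_power)
            thus ?thesis by (simp add: power_mult_distrib)
          qed
          show ?thesis
          proof (cases "N \<le> T + 2")
            case True
            have "1 \<le> 4 ^ N * (\<beta>\<^sup>2) ^ N" by (rule quarter)
            also have "\<dots> \<le> 4 ^ (T + 2) * (\<beta>\<^sup>2) ^ N" using True by (intro mult_right_mono power_increasing) auto
            finally have "3 * \<kappa> * S 0 * 1 \<le> 3 * \<kappa> * S 0 * (4 ^ (T + 2) * (\<beta>\<^sup>2) ^ N)"
              using \<kappa> S_nonneg[of 0] by (intro mult_left_mono) auto
            also have "\<dots> = (3 * \<kappa> * 4 ^ (T + 2)) * ((\<beta>\<^sup>2) ^ N * S 0)" by simp
            also have "\<dots> \<le> C\<^sup>2 * ((\<beta>\<^sup>2) ^ N * S 0)"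
              using C1 S_nonneg[of 0] by (intro mult_right_mono) auto
            finally show ?thesis using S_le[of N] by (simp add: mult.assoc)
          next
            case False
            hence TN: "T + 2 \<le> N" by simp
            have om': "S 0 \<le> \<omega> * (X i1 0)\<^sup>2" using om by (simp add: S_def)
            have "\<theta> (T + 2) \<le> 12 / sqrt \<kappa>"
              using \<kappa>_big crit by (intro slow_phase[OF _ i1 \<omega> om' X_nz h3 T']) auto
            moreover have "\<tau> \<le> 1 / (12 * \<kappa> * (12 / sqrt \<kappa>))"
            proof -
              have "12 * \<kappa> * (12 / sqrt \<kappa>) = 144 * sqrt \<kappa>"
                using \<kappa> by (simp add: field_simps)
              moreover have "1 / (144 * g) \<le> 1 / (144 * sqrt \<kappa>)"
                using gk \<kappa> by (intro divide_left_mono) (auto intro!: mult_pos_pos order.strict_trans2[OF _ gk])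
              ultimately show ?thesis by (simp add: \<tau>_def)
            qed
            moreover have "1 / (144 * g) \<le> 1 / (12 * g)"
              using g2 by (intro divide_left_mono mult_right_mono mult_pos_pos) auto
            ultimately have "S N \<le> 9 * \<kappa> * (2 + \<kappa>) * ((1 - \<tau> / 4) ^ (N - (T + 2)) * S 0)"
              using TN \<theta>N \<tau>0 h2' g2
              by (intro fast_phase[where c = "1 / (4 * g)"]) (auto simp: \<tau>_def g_def)
            also have "\<dots> \<le> 9 * \<kappa> * (2 + \<kappa>) * ((\<beta>\<^sup>2) ^ (N - (T + 2)) * S 0)"
              using \<beta>2 \<kappa> \<tau>1 S_nonneg[of 0] by (intro mult_left_mono mult_right_mono power_mono) auto
            also have "\<dots> \<le> 9 * \<kappa> * (2 + \<kappa>) * ((4 ^ (T + 2) * (\<beta>\<^sup>2) ^ N) * S 0)"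
            proof -
              have "(\<beta>\<^sup>2) ^ (N - (T + 2)) * 1 \<le> (\<beta>\<^sup>2) ^ (N - (T + 2)) * (4 ^ (T + 2) * (\<beta>\<^sup>2) ^ (T + 2))"
                by (intro mult_left_mono quarter) auto
              also have "\<dots> = 4 ^ (T + 2) * ((\<beta>\<^sup>2) ^ (N - (T + 2)) * (\<beta>\<^sup>2) ^ (T + 2))" by simp
              also have "(\<beta>\<^sup>2) ^ (N - (T + 2)) * (\<beta>\<^sup>2) ^ (T + 2) = (\<beta>\<^sup>2) ^ N"
                using TN by (metis power_add le_add_diff_inverse2)
              finally have "(\<beta>\<^sup>2) ^ (N - (T + 2)) \<le> 4 ^ (T + 2) * (\<beta>\<^sup>2) ^ N" by simp
              thus ?thesis using \<kappa> S_nonneg[of 0] by (intro mult_left_mono mult_right_mono) auto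
            qed
            also have "\<dots> = (9 * \<kappa> * (2 + \<kappa>) * 4 ^ (T + 2)) * ((\<beta>\<^sup>2) ^ N * S 0)" by simp
            also have "\<dots> \<le> C\<^sup>2 * ((\<beta>\<^sup>2) ^ N * S 0)"
              using C2 S_nonneg[of 0] by (intro mult_right_mono) auto
            finally show ?thesis by (simp add: mult.assoc)
          qed
        qed
      qed
      also have "C\<^sup>2 * (\<beta>\<^sup>2) ^ N = (C * \<beta> ^ N)\<^sup>2" by (simp add: power_mult_distrib power_power2_swap)
      finally show "(\<Sum>i\<in>I. (X i N)\<^sup>2)
          \<le> (C * (1 - 1 / (1152 * sqrt (\<gamma> * \<kappa>))) ^ N)\<^sup>2 * (\<Sum>i\<in>I. (X i 0)\<^sup>2)"
        by (simp add: S_def \<beta>_def g_def)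
    qed
  qed
qed

section \<open>The algorithm in the eigenbasis\<close>

lemma orthonormal_expansion:
  fixes v :: "nat \<Rightarrow> 'a::real_inner"
  assumes orth: "\<And>i j. i \<in> I \<Longrightarrow> j \<in> I \<Longrightarrow> v i \<bullet> v j = (if i = j then 1 else 0)"
    and fin: "finite I" and x: "x \<in> span (v ` I)"
  shows "(\<Sum>i\<in>I. (x \<bullet> v i) *\<^sub>R v i) = x"
  using x
proof (rule span_induct)
  show "subspace {x. (\<Sum>i\<in>I. (x \<bullet> v i) *\<^sub>R v i) = x}"
    by (auto intro!: subspaceI simp: inner_add_left scaleR_add_left sum.distrib
        simp flip: scaleR_scaleR scaleR_sum_right)
  fix x assume "x \<in> v ` I"
  then obtain j where j: "j \<in> I" "x = v j" by auto
  have "(\<Sum>i\<in>I. (v j \<bullet> v i) *\<^sub>R v i) = (\<Sum>i\<in>I. if j = i then v i else 0)"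
    using j orth by (intro sum.cong) auto
  also have "\<dots> = v j" using j fin by simp
  finally show "(\<Sum>i\<in>I. (x \<bullet> v i) *\<^sub>R v i) = x" using j by simp
qed

lemma orthonormal_parseval:
  fixes v :: "nat \<Rightarrow> 'a::real_inner"
  assumes orth: "\<And>i j. i \<in> I \<Longrightarrow> j \<in> I \<Longrightarrow> v i \<bullet> v j = (if i = j then 1 else 0)"
    and fin: "finite I" and x: "x \<in> span (v ` I)"
  shows "(norm x)\<^sup>2 = (\<Sum>i\<in>I. (x \<bullet> v i)\<^sup>2)"
proof -
  have "(norm x)\<^sup>2 = x \<bullet> (\<Sum>i\<in>I. (x \<bullet> v i) *\<^sub>R v i)"
    by (simp add: orthonormal_expansion[OF assms] power2_norm_eq_inner)
  thus ?thesis by (simp add: inner_sum_right power2_eq_square)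
qed

text \<open>A derivative within \<open>E\<close> is tested only in directions of \<open>E\<close>.
  The difference of two candidates is such a direction, and restriction to its line shows that it is
  orthogonal to itself.\<close>

lemma grad_on_eqI:
  fixes E :: "'a::real_inner set"
  assumes E: "subspace E" "x \<in> E" and g: "g \<in> E" "(f has_derivative (\<lambda>h. g \<bullet> h)) (at x within E)"
  shows "grad_on E f x = g"
  unfolding grad_on_def
proof (rule the_equality)
  fix g' assume g': "g' \<in> E \<and> (f has_derivative (\<lambda>h. g' \<bullet> h)) (at x within E)"
  define u where "u = g' - g"
  have u: "u \<in> E" using E g g' by (simp add: u_def subspace_diff)
  have line: "((\<lambda>s. f (x + s *\<^sub>R u)) has_derivative (\<lambda>s. w \<bullet> (s *\<^sub>R u))) (at 0)"
    if "(f has_derivative (\<lambda>h. w \<bullet> h)) (at x within E)" for w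
  proof -
    have "(f has_derivative (\<lambda>h. w \<bullet> h)) (at (x + 0 *\<^sub>R u) within range (\<lambda>s. x + s *\<^sub>R u))"
      using that E u by (auto intro!: has_derivative_subset[of _ _ _ E] subspace_add subspace_scale)
    moreover have "((\<lambda>s. x + s *\<^sub>R u) has_derivative (\<lambda>s. s *\<^sub>R u)) (at 0)"
      by (auto intro!: derivative_eq_intros)
    ultimately show ?thesis by (rule has_derivative_in_compose[rotated])
  qed
  have "(\<lambda>s::real. g' \<bullet> (s *\<^sub>R u)) = (\<lambda>s. g \<bullet> (s *\<^sub>R u))"
    using line g' g by (intro has_derivative_unique) blast+
  from fun_cong[OF this, of 1] have "u \<bullet> u = 0" by (simp add: u_def inner_diff_left)
  thus "g' = g" by (simp add: u_def)
qed (use g in blast)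

text \<open>The type need not be complete, so the vector representing the derivative is built from
  the finite orthonormal family.\<close>

lemma grad_on_in_subspace:
  fixes v :: "nat \<Rightarrow> 'a::real_inner"
  assumes orth: "\<And>i j. i \<in> I \<Longrightarrow> j \<in> I \<Longrightarrow> v i \<bullet> v j = (if i = j then 1 else 0)"
    and fin: "finite I" and E: "span (v ` I) = E" and x: "x \<in> E" and f: "f differentiable (at x within E)"
  shows "grad_on E f x \<in> E"
proof -
  obtain f' where f': "(f has_derivative f') (at x within E)" using f by (auto simp: differentiable_def)
  interpret bounded_linear f' using f' by (rule has_derivative_bounded_linear)
  define g where "g = (\<Sum>i\<in>I. f' (v i) *\<^sub>R v i)"
  have sub: "subspace E" using E subspace_span by blast
  have g: "g \<in> E" unfolding g_def E[symmetric] by (intro span_sum span_scale span_base imageI)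
  have gh: "g \<bullet> h = f' h" if "h \<in> E" for h
  proof -
    have "f' h = f' (\<Sum>i\<in>I. (h \<bullet> v i) *\<^sub>R v i)" using orthonormal_expansion[OF orth fin] that E by simp
    also have "\<dots> = (\<Sum>i\<in>I. (h \<bullet> v i) * f' (v i))" by (simp add: sum scaleR)
    also have "\<dots> = h \<bullet> g" by (simp add: g_def inner_sum_right mult.commute)
    also have "\<dots> = g \<bullet> h" by (rule inner_commute)
    finally show ?thesis ..
  qed
  have "(f has_derivative (\<lambda>h. g \<bullet> h)) (at x within E)"
    unfolding has_derivative_within_alt
  proof (intro conjI allI impI)
    fix e :: real assume "0 < e"
    then obtain d where "0 < d" "\<forall>y\<in>E. norm (y - x) < d \<longrightarrow> norm (f y - f x - f' (y - x)) \<le> e * norm (y - x)"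
      using f' unfolding has_derivative_within_alt by blast
    thus "\<exists>d>0. \<forall>y\<in>E. norm (y - x) < d \<longrightarrow> norm (f y - f x - g \<bullet> (y - x)) \<le> e * norm (y - x)"
      using gh sub x by (auto simp: subspace_diff)
  qed (rule bounded_linear_inner_right)
  from grad_on_eqI[OF sub x g this] g show ?thesis by simp
qed

section \<open>The objective near its minimizer and the state of the algorithm\<close>

locale nag_problem =
  fixes E :: "'a::real_inner set" and f :: "'a \<Rightarrow> real" and L m :: real and xs :: 'a
    and v :: "nat \<Rightarrow> 'a" and lam :: "nat \<Rightarrow> real" and d :: nat and L0 \<gamma> \<gamma>L :: real
  assumes sub: "subspace E" and d: "1 \<le> d" and S_Lm: "smooth_strongly_convex E L m f"
    and min: "unique_minimizer E f xs" and diff2: "twice_differentiable_on f E"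
    and basis: "orthonormal_eigenbasis E (hess_on E f xs) d v lam"
    and m_lam: "m = lam 1" and L_lam: "L = lam d" and L0: "L < L0" and \<gamma>: "1 < \<gamma>" and L_div_m: "4 \<le> L / m"
begin

abbreviation "g \<equiv> grad_on E f"

lemma m_pos: "0 < m" and L_pos: "0 < L" and L0_pos: "0 < L0"
  using S_Lm L0 by (auto simp: smooth_strongly_convex_def)

lemma lower: "x \<in> E \<Longrightarrow> y \<in> E \<Longrightarrow> f x + g x \<bullet> (y - x) + m / 2 * (norm (y - x))\<^sup>2 \<le> f y"
  and upper: "x \<in> E \<Longrightarrow> y \<in> E \<Longrightarrow> f y \<le> f x + g x \<bullet> (y - x) + L / 2 * (norm (y - x))\<^sup>2"
  using S_Lm by (auto simp: smooth_strongly_convex_def)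

lemma orth: "i \<in> {1..d} \<Longrightarrow> j \<in> {1..d} \<Longrightarrow> v i \<bullet> v j = (if i = j then 1 else 0)"
  and span_v: "span (v ` {1..d}) = E"
  and eigen: "i \<in> {1..d} \<Longrightarrow> hess_on E f xs (v i) = lam i *\<^sub>R v i"
  and lam_mono: "mono_on {1..d} lam"
  using basis by (auto simp: orthonormal_eigenbasis_def)

lemma expansion: "x \<in> E \<Longrightarrow> (\<Sum>i\<in>{1..d}. (x \<bullet> v i) *\<^sub>R v i) = x"
  using orthonormal_expansion[OF orth, of "{1..d}"] span_v by simp

lemma parseval: "x \<in> E \<Longrightarrow> (norm x)\<^sup>2 = (\<Sum>i\<in>{1..d}. (x \<bullet> v i)\<^sup>2)"
  using orthonormal_parseval[OF orth, of "{1..d}"] span_v by simp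

lemma lam_bounds: "i \<in> {1..d} \<Longrightarrow> m \<le> lam i" "i \<in> {1..d} \<Longrightarrow> lam i \<le> L"
  using d mono_onD[OF lam_mono, of 1 i] mono_onD[OF lam_mono, of i d] by (auto simp: m_lam L_lam)

lemma xs_in: "xs \<in> E" and xs_min: "x \<in> E \<Longrightarrow> f xs \<le> f x"
  using min by (auto simp: unique_minimizer_def is_arg_min_linorder)

lemma g_in: "x \<in> E \<Longrightarrow> g x \<in> E"
  using grad_on_in_subspace[OF orth _ span_v] diff2
  by (simp add: twice_differentiable_on_def differentiable_on_def)

text \<open>The acceptance test of backtracking, valid for every step parameter from
  \<open>L\<close> on.\<close>

lemma descent:
  assumes x: "x \<in> E" and l: "L \<le> l"
  shows "f (x - (1 / l) *\<^sub>R g x) \<le> f x - 1 / (2 * l) * (norm (g x))\<^sup>2"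
proof -
  have l0: "0 < l" using l L_pos by simp
  have "f (x - (1 / l) *\<^sub>R g x)
      \<le> f x + g x \<bullet> ((x - (1 / l) *\<^sub>R g x) - x) + L / 2 * (norm ((x - (1 / l) *\<^sub>R g x) - x))\<^sup>2"
    using x g_in[OF x] sub by (intro upper) (auto intro!: subspace_diff subspace_scale)
  also have "\<dots> = f x - (norm (g x))\<^sup>2 / l + L / 2 * ((norm (g x))\<^sup>2 / l\<^sup>2)"
    using l0 by (simp add: power2_norm_eq_inner power_divide)
  also have "L / 2 * ((norm (g x))\<^sup>2 / l\<^sup>2) \<le> l / 2 * ((norm (g x))\<^sup>2 / l\<^sup>2)"
    using l by (intro mult_right_mono) auto
  also have "f x - (norm (g x))\<^sup>2 / l + l / 2 * ((norm (g x))\<^sup>2 / l\<^sup>2) = f x - 1 / (2 * l) * (norm (g x))\<^sup>2"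
    using l0 by (simp add: field_simps power2_eq_square)
  finally show ?thesis by simp
qed

text \<open>A gradient step from the minimizer cannot decrease \<open>f\<close>.\<close>

lemma g_xs: "g xs = 0"
proof -
  have "f xs \<le> f (xs - (1 / L) *\<^sub>R g xs)"
    using xs_in g_in sub by (intro xs_min) (auto intro!: subspace_diff subspace_scale)
  also have "\<dots> \<le> f xs - 1 / (2 * L) * (norm (g xs))\<^sup>2" using descent[OF xs_in, of L] by simp
  finally have "1 / (2 * L) * (norm (g xs))\<^sup>2 \<le> 0" by simp
  thus ?thesis using L_pos by (simp add: field_simps)
qed

text \<open>The two strong convexity inequalities are added and Cauchy-Schwarz applied. This is why
  every defined quotient c_t is at least \<open>m\<close>.\<close>

lemma g_strongly_monotone:
  assumes "x \<in> E" "y \<in> E"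
  shows "m * norm (y - x) \<le> norm (g y - g x)"
proof -
  have "m * (norm (y - x))\<^sup>2 \<le> (g y - g x) \<bullet> (y - x)"
    using lower[OF assms] lower[OF assms(2,1)] norm_minus_commute[of x y]
    by (simp add: inner_diff_left inner_diff_right)
  also have "\<dots> \<le> norm (g y - g x) * norm (y - x)" by (rule norm_cauchy_schwarz)
  finally have "(m * norm (y - x)) * norm (y - x) \<le> norm (g y - g x) * norm (y - x)"
    by (simp add: power2_eq_square)
  thus ?thesis by (cases "y = x") auto
qed

lemma hess_inner:
  assumes e: "e \<in> E" and i: "i \<in> {1..d}"
  shows "hess_on E f xs e \<bullet> v i = lam i * (e \<bullet> v i)" "hess_on E f xs e \<in> E"
proof -
  interpret bounded_linear "hess_on E f xs"
    using diff2 xs_in unfolding hess_on_def twice_differentiable_on_def differentiable_on_def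
    by (auto intro: has_derivative_bounded_linear simp: frechet_derivative_works)
  have "hess_on E f xs e = hess_on E f xs (\<Sum>j\<in>{1..d}. (e \<bullet> v j) *\<^sub>R v j)" using expansion[OF e] by simp
  also have "\<dots> = (\<Sum>j\<in>{1..d}. (e \<bullet> v j) *\<^sub>R (lam j *\<^sub>R v j))" by (simp add: sum scaleR eigen)
  finally have *: "hess_on E f xs e = (\<Sum>j\<in>{1..d}. (e \<bullet> v j) *\<^sub>R (lam j *\<^sub>R v j))" .
  show "hess_on E f xs e \<in> E" unfolding * using span_v
    by (metis (no_types, lifting) span_sum span_scale span_base imageI)
  have "hess_on E f xs e \<bullet> v i = (\<Sum>j\<in>{1..d}. if i = j then lam i * (e \<bullet> v i) else 0)"
    unfolding * inner_sum_left using orth i by (intro sum.cong) auto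
  thus "hess_on E f xs e \<bullet> v i = lam i * (e \<bullet> v i)" using i by simp
qed

text \<open>Differentiability of the gradient at \<open>xs\<close>, where it vanishes.
  \<open>\<eta>\<close> stays free because the tolerance \<open>h\<close> of the modes is fixed
  first.\<close>

lemma g_linearization:
  assumes "0 < \<eta>"
  obtains \<rho> where "0 < \<rho>"
    "\<And>x. x \<in> E \<Longrightarrow> norm (x - xs) < \<rho> \<Longrightarrow> norm (g x - hess_on E f xs (x - xs)) \<le> \<eta> * norm (x - xs)"
proof -
  have "(g has_derivative hess_on E f xs) (at xs within E)"
    using diff2 xs_in unfolding hess_on_def twice_differentiable_on_def differentiable_on_def
    by (simp add: frechet_derivative_works)
  then obtain \<rho> where "0 < \<rho>"
    "\<forall>y\<in>E. norm (y - xs) < \<rho> \<longrightarrow> norm (g y - g xs - hess_on E f xs (y - xs)) \<le> \<eta> * norm (y - xs)"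
    using assms unfolding has_derivative_within_alt by blast
  thus ?thesis using g_xs by (intro that) auto
qed

lemma backtrack: "x \<in> E \<Longrightarrow> nag_backtrack E f \<gamma>L x L0 = L0"
  unfolding nag_backtrack_def
  by (subst while_unfold) (use descent[of x L0] L0 in auto)

definition st_y :: "'a \<Rightarrow> nat \<Rightarrow> 'a" where
  "st_y x0 t = fst (snd (nag_free E f L0 \<gamma> \<gamma>L x0 t))"

abbreviation "st_x \<equiv> nag_x E f L0 \<gamma> \<gamma>L"
abbreviation "st_m \<equiv> nag_m E f L0 \<gamma> \<gamma>L"
abbreviation "quot x0 t \<equiv> norm (g (st_x x0 (Suc t)) - g (st_x x0 t)) / norm (st_x x0 (Suc t) - st_x x0 t)"

lemma nag_0: "st_x x0 0 = x0" "st_y x0 0 = x0" "st_m x0 0 = L0"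
  by (auto simp: nag_x_def st_y_def nag_m_def)

lemma nag_state:
  assumes "x0 \<in> E"
  shows "nag_free E f L0 \<gamma> \<gamma>L x0 t = (st_x x0 t, st_y x0 t, L0, st_m x0 t) \<and> st_x x0 t \<in> E \<and> st_y x0 t \<in> E"
proof (induction t)
  case 0
  show ?case using assms by (simp add: nag_x_def st_y_def nag_m_def)
next
  case (Suc t)
  hence "nag_free E f L0 \<gamma> \<gamma>L x0 t = (st_x x0 t, st_y x0 t, L0, st_m x0 t)" "st_x x0 t \<in> E" "st_y x0 t \<in> E"
    by auto
  thus ?case using sub g_in
    by (auto simp: nag_x_def[of _ _ _ _ _ _ "Suc t"] st_y_def[of _ "Suc t"] nag_m_def[of _ _ _ _ _ _ "Suc t"]
        Let_def backtrack intro!: subspace_add subspace_scale subspace_diff)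
qed

lemma nag_Suc:
  assumes "x0 \<in> E"
  shows "st_y x0 (Suc t) = st_x x0 t - (1 / L0) *\<^sub>R g (st_x x0 t)"
    "st_x x0 (Suc t) = st_y x0 (Suc t) +
      ((sqrt L0 - sqrt (st_m x0 t)) / (sqrt L0 + sqrt (st_m x0 t))) *\<^sub>R (st_y x0 (Suc t) - st_y x0 t)"
    "st_m x0 (Suc t) = (if quot x0 t < st_m x0 t then min (st_m x0 t / \<gamma>) (quot x0 t) else st_m x0 t)"
  using nag_state[OF assms, of t]
  by (auto simp: nag_x_def[of _ _ _ _ _ _ "Suc t"] st_y_def[of _ "Suc t"] nag_m_def[of _ _ _ _ _ _ "Suc t"]
      Let_def backtrack)

text \<open>These hold even where the quotient has denominator zero: its default value 0 then sets
  the estimate to 0. So the coordinate sequences satisfy \<open>nag_modes\<close> for all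
  \<open>t\<close>.\<close>

lemma st_m_props:
  assumes x0: "x0 \<in> E"
  shows "0 \<le> st_m x0 t" "st_m x0 (Suc t) \<le> st_m x0 t" "st_m x0 (Suc t) \<le> quot x0 t"
proof -
  show *: "0 \<le> st_m x0 t" for t
    by (induction t) (use L0_pos \<gamma> in \<open>auto simp: nag_0 nag_Suc[OF x0]\<close>)
  show "st_m x0 (Suc t) \<le> st_m x0 t" "st_m x0 (Suc t) \<le> quot x0 t"
    unfolding nag_Suc(3)[OF x0] by auto
qed

text \<open>The division by \<open>\<gamma>\<close> happens only when the estimate exceeds the
  quotient, hence exceeds \<open>m\<close>.\<close>

lemma st_m_lower:
  assumes x0: "x0 \<in> E" and "nag_defined E f L0 \<gamma> \<gamma>L x0 t"
  shows "m / \<gamma> \<le> st_m x0 t"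
  using assms(2)
proof (induction t)
  case 0
  have "m \<le> L" using lam_bounds[of d] d by simp
  moreover have "m / \<gamma> \<le> m / 1" using m_pos \<gamma> by (intro divide_left_mono) auto
  ultimately show ?case using L0 by (simp add: nag_0)
next
  case (Suc t)
  have IH: "m / \<gamma> \<le> st_m x0 t" using Suc by (auto simp: nag_defined_def)
  have "st_x x0 (Suc t) \<noteq> st_x x0 t" using Suc.prems by (auto simp: nag_defined_def)
  hence c: "m \<le> quot x0 t"
    using g_strongly_monotone[of "st_x x0 t" "st_x x0 (Suc t)"] nag_state[OF x0]
    by (simp add: pos_le_divide_eq)
  show ?case
  proof (cases "quot x0 t < st_m x0 t")
    case True
    have "m / \<gamma> \<le> m / 1" using m_pos \<gamma> by (intro divide_left_mono) auto
    moreover have "m / \<gamma> \<le> st_m x0 t / \<gamma>" using c True \<gamma> by (intro divide_right_mono) auto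
    ultimately show ?thesis using c True unfolding nag_Suc(3)[OF x0] by simp
  next
    case False
    thus ?thesis using IH unfolding nag_Suc(3)[OF x0] by simp
  qed
qed

section \<open>Passage to eigenbasis coordinates\<close>

definition kappa_bar :: real where "kappa_bar = L0 / m"
definition coord_q :: "nat \<Rightarrow> real" where "coord_q i = lam i / L0"
definition coord_X :: "'a \<Rightarrow> nat \<Rightarrow> nat \<Rightarrow> real" where "coord_X x0 i t = (st_x x0 t - xs) \<bullet> v i"
definition coord_Y :: "'a \<Rightarrow> nat \<Rightarrow> nat \<Rightarrow> real" where "coord_Y x0 i t = (st_y x0 t - xs) \<bullet> v i"
definition coord_D :: "'a \<Rightarrow> nat \<Rightarrow> nat \<Rightarrow> real" where
  "coord_D x0 i t = (case t of 0 \<Rightarrow> 0 | Suc s \<Rightarrow> (st_y x0 (Suc s) - st_y x0 s) \<bullet> v i)"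
definition coord_r :: "'a \<Rightarrow> nat \<Rightarrow> nat \<Rightarrow> real" where
  "coord_r x0 i t = coord_q i * coord_X x0 i t - (g (st_x x0 t) \<bullet> v i) / L0"

text \<open>\<open>x\<^sub>t\<close> is computed with \<open>m\<^bsub>t-1\<^esub>\<close>, hence the shift; at \<open>t = 0\<close> the value is irrelevant since \<open>y\<^sub>0 = x\<^sub>0\<close>.\<close>
definition damping :: "'a \<Rightarrow> nat \<Rightarrow> real" where
  "damping x0 t = (case t of 0 \<Rightarrow> 1 | Suc s \<Rightarrow> sqrt (st_m x0 s / L0))"

lemma kappa_bar_ge_4: "4 \<le> kappa_bar"
proof -
  have "L / m \<le> L0 / m" using L0 m_pos by (intro divide_right_mono) auto
  thus ?thesis using L_div_m by (simp add: kappa_bar_def)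
qed

lemma coord_norm_sq: "x0 \<in> E \<Longrightarrow> (\<Sum>i\<in>{1..d}. (coord_X x0 i t)\<^sup>2) = (norm (st_x x0 t - xs))\<^sup>2"
  unfolding coord_X_def using nag_state xs_in sub by (subst parseval) (auto simp: subspace_diff)

lemma coord_r_norm_sq:
  assumes x0: "x0 \<in> E"
  shows "(\<Sum>i\<in>{1..d}. (coord_r x0 i t)\<^sup>2)
    = (norm (g (st_x x0 t) - hess_on E f xs (st_x x0 t - xs)))\<^sup>2 / L0\<^sup>2"
proof -
  have in_E: "st_x x0 t - xs \<in> E" using nag_state[OF x0] xs_in sub by (simp add: subspace_diff)
  have "coord_r x0 i t = - (((g (st_x x0 t) - hess_on E f xs (st_x x0 t - xs)) \<bullet> v i) / L0)"
    if "i \<in> {1..d}" for i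
    using hess_inner(1)[OF in_E that]
    by (simp add: coord_r_def coord_q_def coord_X_def inner_diff_left[of "g _"] diff_divide_distrib)
  hence "(\<Sum>i\<in>{1..d}. (coord_r x0 i t)\<^sup>2)
      = (\<Sum>i\<in>{1..d}. ((g (st_x x0 t) - hess_on E f xs (st_x x0 t - xs)) \<bullet> v i)\<^sup>2 / L0\<^sup>2)"
    by (intro sum.cong) (auto simp: power_divide)
  moreover have "g (st_x x0 t) - hess_on E f xs (st_x x0 t - xs) \<in> E"
    using nag_state[OF x0] g_in sub d hess_inner(2)[OF in_E, of 1] by (intro subspace_diff) auto
  ultimately show ?thesis by (simp add: parseval sum_divide_distrib)
qed

lemma coord_modes:
  assumes x0: "x0 \<in> E"
  shows "nag_modes {1..d} coord_q (coord_X x0) (coord_Y x0) (coord_D x0) (coord_r x0) (damping x0) kappa_bar"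
proof
  show "4 \<le> kappa_bar" by (rule kappa_bar_ge_4)
  fix i assume i: "i \<in> {1..d}"
  show "1 / kappa_bar \<le> coord_q i"
    using lam_bounds(1)[OF i] L0_pos by (simp add: kappa_bar_def coord_q_def divide_right_mono)
  show "coord_q i \<le> 1" using lam_bounds(2)[OF i] L0 L0_pos by (simp add: coord_q_def)
next
  fix i t
  show "coord_X x0 i t = coord_Y x0 i t + mom (damping x0 t) * coord_D x0 i t"
  proof (cases t)
    case (Suc s)
    have "mom (damping x0 t) = (sqrt L0 - sqrt (st_m x0 s)) / (sqrt L0 + sqrt (st_m x0 s))"
    proof -
      have "mom (damping x0 t) = (1 - sqrt (st_m x0 s) / sqrt L0) / (1 + sqrt (st_m x0 s) / sqrt L0)"
        by (simp add: mom_def damping_def Suc real_sqrt_divide)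
      also have "\<dots> = ((1 - sqrt (st_m x0 s) / sqrt L0) * sqrt L0) / ((1 + sqrt (st_m x0 s) / sqrt L0) * sqrt L0)"
        using L0_pos by simp
      also have "\<dots> = (sqrt L0 - sqrt (st_m x0 s)) / (sqrt L0 + sqrt (st_m x0 s))"
        using L0_pos by (simp add: left_diff_distrib distrib_right)
      finally show ?thesis .
    qed
    thus ?thesis
      by (simp add: coord_X_def coord_Y_def coord_D_def Suc nag_Suc(2)[OF x0, of s] inner_diff_left inner_add_left)
  qed (simp add: coord_X_def coord_Y_def coord_D_def nag_0)
  show "coord_Y x0 i (Suc t) = (1 - coord_q i) * coord_X x0 i t + coord_r x0 i t"
    by (simp add: coord_Y_def coord_r_def coord_X_def nag_Suc(1)[OF x0] inner_diff_left algebra_simps)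
  show "coord_D x0 i (Suc t) = coord_Y x0 i (Suc t) - coord_Y x0 i t"
    by (simp add: coord_D_def coord_Y_def inner_diff_left)
  show "0 \<le> damping x0 t" using st_m_props(1)[OF x0] L0_pos by (auto simp: damping_def split: nat.split)
  show "damping x0 (Suc t) \<le> damping x0 t"
  proof (cases t)
    case 0
    thus ?thesis using L0_pos by (simp add: damping_def nag_0)
  next
    case (Suc s)
    thus ?thesis using st_m_props(2)[OF x0, of s] L0_pos by (simp add: damping_def divide_right_mono)
  qed
qed (auto simp: coord_D_def damping_def)

text \<open>The square of m_{t+1} \<le> c_{t+1}, divided by \<open>L0\<^sup>2\<close>; the damping
  at index \<open>t + 2\<close> is formed from m_{t+1}. If the iterate has not moved, both sides
  vanish.\<close>

lemma coord_crit:
  assumes x0: "x0 \<in> E"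
  shows "(damping x0 (t + 2)) ^ 4 * (\<Sum>i\<in>{1..d}. (coord_X x0 i (Suc t) - coord_X x0 i t)\<^sup>2)
    \<le> (\<Sum>i\<in>{1..d}. (coord_q i * (coord_X x0 i (Suc t) - coord_X x0 i t) - (coord_r x0 i (Suc t) - coord_r x0 i t))\<^sup>2)"
proof -
  define \<Delta> G where "\<Delta> = st_x x0 (Suc t) - st_x x0 t" and "G = g (st_x x0 (Suc t)) - g (st_x x0 t)"
  have in_E: "\<Delta> \<in> E" "G \<in> E" using nag_state[OF x0] g_in sub by (auto simp: \<Delta>_def G_def intro!: subspace_diff)
  have "st_m x0 (Suc t) * norm \<Delta> \<le> norm G"
  proof (cases "\<Delta> = 0")
    case False
    thus ?thesis using st_m_props(3)[OF x0, of t] by (simp add: \<Delta>_def G_def pos_le_divide_eq)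
  qed simp
  hence "(st_m x0 (Suc t) * norm \<Delta>)\<^sup>2 \<le> (norm G)\<^sup>2"
    using st_m_props(1)[OF x0, of "Suc t"] by (intro power_mono) auto
  hence "(st_m x0 (Suc t) * norm \<Delta>)\<^sup>2 / L0\<^sup>2 \<le> (norm G)\<^sup>2 / L0\<^sup>2" by (intro divide_right_mono) auto
  moreover have "(damping x0 (t + 2)) ^ 4 = (st_m x0 (Suc t) / L0)\<^sup>2"
  proof -
    have "(damping x0 (t + 2)) ^ 4 = ((sqrt (st_m x0 (Suc t) / L0))\<^sup>2)\<^sup>2" by (simp add: damping_def)
    also have "(sqrt (st_m x0 (Suc t) / L0))\<^sup>2 = st_m x0 (Suc t) / L0"
      using st_m_props(1)[OF x0, of "Suc t"] L0_pos by (intro real_sqrt_pow2) auto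
    finally show ?thesis .
  qed
  moreover have "(\<Sum>i\<in>{1..d}. (coord_X x0 i (Suc t) - coord_X x0 i t)\<^sup>2) = (norm \<Delta>)\<^sup>2"
    using parseval[OF in_E(1)] by (simp add: coord_X_def \<Delta>_def inner_diff_left)
  moreover have "(\<Sum>i\<in>{1..d}. (coord_q i * (coord_X x0 i (Suc t) - coord_X x0 i t) - (coord_r x0 i (Suc t) - coord_r x0 i t))\<^sup>2)
      = (norm G)\<^sup>2 / L0\<^sup>2"
  proof -
    have "coord_q i * (coord_X x0 i (Suc t) - coord_X x0 i t) - (coord_r x0 i (Suc t) - coord_r x0 i t) = (G \<bullet> v i) / L0" for i
      by (simp add: coord_r_def G_def inner_diff_left diff_divide_distrib algebra_simps)
    thus ?thesis using parseval[OF in_E(2)] by (simp add: power_divide sum_divide_distrib)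
  qed
  ultimately show ?thesis by (simp add: power_mult_distrib power_divide)
qed

text \<open>The index may reach \<open>Suc t\<close> because the damping there uses the estimate at
  \<open>t\<close>.\<close>

lemma damping_lower:
  assumes x0: "x0 \<in> E" and def: "nag_defined E f L0 \<gamma> \<gamma>L x0 t" and s: "s \<le> Suc t"
  shows "1 / sqrt (\<gamma> * kappa_bar) \<le> damping x0 s"
proof (cases s)
  case 0
  have "1 * 1 \<le> \<gamma> * kappa_bar" using \<gamma> kappa_bar_ge_4 by (intro mult_mono) auto
  thus ?thesis using 0 by (simp add: damping_def)
next
  case (Suc u)
  hence "nag_defined E f L0 \<gamma> \<gamma>L x0 u" using def s by (auto simp: nag_defined_def)
  hence "m / \<gamma> \<le> st_m x0 u" by (rule st_m_lower[OF x0])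
  hence "(m / \<gamma>) / L0 \<le> st_m x0 u / L0" using L0_pos by (intro divide_right_mono) auto
  hence "sqrt ((m / \<gamma>) / L0) \<le> damping x0 s" unfolding Suc damping_def by simp
  moreover have "(m / \<gamma>) / L0 = 1 / (\<gamma> * kappa_bar)" using m_pos by (simp add: kappa_bar_def)
  ultimately show ?thesis by (metis real_sqrt_divide real_sqrt_one)
qed

lemma local_rate:
  assumes \<omega>: "0 < \<omega>" and C: "modes_constant kappa_bar \<omega> C"
  shows "\<exists>\<epsilon>>0. \<forall>x0\<in>E. (norm (x0 - xs))\<^sup>2 \<le> \<omega> * ((x0 - xs) \<bullet> v 1)\<^sup>2 \<and> norm (x0 - xs) \<le> \<epsilon> \<longrightarrow>
    (\<forall>t. nag_defined E f L0 \<gamma> \<gamma>L x0 t \<longrightarrow>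
       norm (st_x x0 (Suc t) - xs) \<le> C * (1 - 1 / (1152 * sqrt (\<gamma> * kappa_bar))) ^ t * norm (x0 - xs))"
proof -
  have C0: "0 < C" using C by (simp add: modes_constant_def)
  obtain h where h: "0 < h" "h * (48 * kappa_bar\<^sup>2 * (1 + 4 * kappa_bar)) \<le> 1"
    and rate: "modes_rate kappa_bar \<omega> \<gamma> C h"
    using C \<gamma> unfolding modes_constant_def by auto
  \<comment> \<open>After squaring and division by \<open>L0\<^sup>2\<close>, the accuracy
    \<open>L0 * sqrt h\<close> becomes the factor \<open>h\<close> between \<open>R\<close> and
    \<open>S\<close>.\<close>
  obtain \<rho> where \<rho>: "0 < \<rho>"
    "\<And>x. x \<in> E \<Longrightarrow> norm (x - xs) < \<rho> \<Longrightarrow>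
      norm (g x - hess_on E f xs (x - xs)) \<le> (L0 * sqrt h) * norm (x - xs)"
    using g_linearization[of "L0 * sqrt h"] h L0_pos by auto
  \<comment> \<open>Makes \<open>3 * kappa_bar * \<epsilon>\<^sup>2\<close> equal to
    \<open>(\<rho> / 2)\<^sup>2\<close>, as the bootstrap requires; the half turns the strict radius
    into a closed one.\<close>
  define \<epsilon> where "\<epsilon> = (\<rho> / 2) / sqrt (3 * kappa_bar)"
  have \<epsilon>: "0 < \<epsilon>" using \<rho>(1) kappa_bar_ge_4 by (simp add: \<epsilon>_def)
  show ?thesis
  proof (intro exI[of _ \<epsilon>] conjI \<epsilon> ballI impI allI)
    fix x0 t
    assume x0: "x0 \<in> E" and asm: "(norm (x0 - xs))\<^sup>2 \<le> \<omega> * ((x0 - xs) \<bullet> v 1)\<^sup>2 \<and> norm (x0 - xs) \<le> \<epsilon>"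
      and def: "nag_defined E f L0 \<gamma> \<gamma>L x0 t"
    interpret modes: nag_modes "{1..d}" coord_q "coord_X x0" "coord_Y x0" "coord_D x0" "coord_r x0" "damping x0" kappa_bar
      by (rule coord_modes[OF x0])
    have S: "modes.S s = (norm (st_x x0 s - xs))\<^sup>2" for s
      unfolding modes.S_def by (rule coord_norm_sq[OF x0])
    have pert: "modes.R s \<le> h * modes.S s" if "modes.S s \<le> (\<rho> / 2)\<^sup>2" for s
    proof -
      have "norm (st_x x0 s - xs) \<le> \<rho> / 2" by (rule power2_le_imp_le) (use that \<rho>(1) S in simp_all)
      hence "norm (st_x x0 s - xs) < \<rho>" using \<rho>(1) by simp
      hence "norm (g (st_x x0 s) - hess_on E f xs (st_x x0 s - xs)) \<le> (L0 * sqrt h) * norm (st_x x0 s - xs)"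
        using \<rho>(2) nag_state[OF x0] by blast
      hence "(norm (g (st_x x0 s) - hess_on E f xs (st_x x0 s - xs)))\<^sup>2 \<le> ((L0 * sqrt h) * norm (st_x x0 s - xs))\<^sup>2"
        by (intro power_mono) auto
      also have "\<dots> = L0\<^sup>2 * (h * modes.S s)" using h unfolding S power_mult_distrib by simp
      finally show ?thesis using L0_pos
        unfolding modes.R_def coord_r_norm_sq[OF x0] by (simp add: pos_divide_le_eq mult.commute)
    qed
    have S0: "3 * kappa_bar * modes.S 0 \<le> (\<rho> / 2)\<^sup>2"
    proof -
      have "modes.S 0 \<le> \<epsilon>\<^sup>2" unfolding S nag_0 using asm by (intro power_mono) auto
      hence "3 * kappa_bar * modes.S 0 \<le> 3 * kappa_bar * \<epsilon>\<^sup>2" using kappa_bar_ge_4 by (intro mult_left_mono) auto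
      also have "\<dots> = (\<rho> / 2)\<^sup>2" using kappa_bar_ge_4 by (simp add: \<epsilon>_def power_divide)
      finally show ?thesis .
    qed
    have "modes.R s \<le> h * modes.S s" for s
      using modes.perturbation_small[OF pert S0 _ h(2)] h(1) by simp
    hence perturbed: "nag_modes_perturbed {1..d} coord_q (coord_X x0) (coord_Y x0) (coord_D x0) (coord_r x0) (damping x0) kappa_bar h"
      using h by unfold_locales auto
    have "modes.S (Suc t) \<le> (C * (1 - 1 / (1152 * sqrt (\<gamma> * kappa_bar))) ^ Suc t)\<^sup>2 * modes.S 0"
      unfolding modes.S_def
    proof (rule modes_rateD[OF rate perturbed, of 1])
      show "(1::nat) \<in> {1..d}" using d by simp
      show "coord_q 1 = 1 / kappa_bar" unfolding coord_q_def kappa_bar_def m_lam[symmetric] by simp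
      show "(\<Sum>i\<in>{1..d}. (coord_X x0 i 0)\<^sup>2) \<le> \<omega> * (coord_X x0 1 0)\<^sup>2"
        using asm unfolding coord_norm_sq[OF x0] by (simp add: coord_X_def nag_0)
    qed (use coord_crit[OF x0] damping_lower[OF x0 def] in auto)
    hence "(norm (st_x x0 (Suc t) - xs))\<^sup>2
        \<le> (C * (1 - 1 / (1152 * sqrt (\<gamma> * kappa_bar))) ^ Suc t * norm (x0 - xs))\<^sup>2"
      unfolding S nag_0 by (simp only: power_mult_distrib)
    note sq = this
    define \<beta> where "\<beta> = 1 - 1 / (1152 * sqrt (\<gamma> * kappa_bar))"
    have \<beta>: "0 \<le> \<beta>" "\<beta> \<le> 1"
    proof -
      have "1 * 1 \<le> \<gamma> * kappa_bar" using \<gamma> kappa_bar_ge_4 by (intro mult_mono) auto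
      moreover define x where "x = sqrt (\<gamma> * kappa_bar)"
      ultimately have "1 \<le> x" by simp
      thus "0 \<le> \<beta>" "\<beta> \<le> 1" unfolding \<beta>_def x_def[symmetric] by (auto simp: field_simps)
    qed
    have "0 \<le> C * \<beta> ^ Suc t * norm (x0 - xs)"
      using C0 \<beta> by (intro mult_nonneg_nonneg zero_le_power) auto
    hence "norm (st_x x0 (Suc t) - xs) \<le> C * \<beta> ^ Suc t * norm (x0 - xs)"
      by (rule power2_le_imp_le[OF sq[folded \<beta>_def]])
    \<comment> \<open>The modes give the power \<open>Suc t\<close>; one factor
      \<open>\<beta> \<le> 1\<close> is dropped.\<close>
    also have "\<dots> \<le> C * \<beta> ^ t * norm (x0 - xs)"
      using C0 \<beta> by (intro mult_right_mono mult_left_mono power_decreasing) auto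
    finally show "norm (st_x x0 (Suc t) - xs) \<le> C * (1 - 1 / (1152 * sqrt (\<gamma> * kappa_bar))) ^ t * norm (x0 - xs)"
      by (simp add: \<beta>_def)
  qed
qed

end

theorem theorem4:
  "\<exists>(\<sigma> :: real \<Rightarrow> real) (C :: real \<Rightarrow> real \<Rightarrow> real).
     (\<forall>\<gamma>>1. \<sigma> \<gamma> > 0) \<and>
     (\<forall>(E :: 'a::real_inner set) (d :: nat) (f :: 'a \<Rightarrow> real) (L :: real) (m :: real) (xs :: 'a)
        (v :: nat \<Rightarrow> 'a) (lam :: nat \<Rightarrow> real)
        (L0 :: real) (\<gamma> :: real) (\<gamma>L :: real) (\<delta> :: real) (\<omega> :: real).
        subspace E \<and> dim E = d \<and> d \<ge> 1 \<and>
        smooth_strongly_convex E L m f \<and>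
        unique_minimizer E f xs \<and>
        twice_differentiable_on f E \<and>
        hessian_locally_hoelder E f xs \<and>
        orthonormal_eigenbasis E (hess_on E f xs) d v lam \<and> m = lam 1 \<and> L = lam d \<and>
        L0 > L \<and> \<gamma> > 1 \<and> \<gamma>L > 1 \<and>
        0 < \<delta> \<and> \<delta> < 1 \<and> \<omega> > 0 \<and>
        L0 / m > L / m \<and> L / m \<ge> 4
        \<longrightarrow>
        (\<exists>\<epsilon>>0. \<forall>x0\<in>E.
           (\<forall>t. nag_defined E f L0 \<gamma> \<gamma>L x0 t \<longrightarrow>
              (\<forall>i\<in>{1..d}. lam i > m \<longrightarrow> \<bar>nag_m E f L0 \<gamma> \<gamma>L x0 t - lam i\<bar> > \<delta> * L)) \<and>
           \<omega> * ((x0 - xs) \<bullet> v 1)\<^sup>2 \<ge> (norm (x0 - xs))\<^sup>2 \<and>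
           norm (x0 - xs) \<le> \<epsilon>
           \<longrightarrow>
           (\<forall>t. nag_defined E f L0 \<gamma> \<gamma>L x0 t \<longrightarrow>
              norm (nag_x E f L0 \<gamma> \<gamma>L x0 (Suc t) - xs)
                \<le> C (L0 / m) \<omega> * (1 - 1 / sqrt (\<sigma> \<gamma> * (L0 / m))) ^ t * norm (x0 - xs))))"
proof -
  \<comment> \<open>The choice is made from \<open>\<kappa>\<close> and \<open>\<omega>\<close>
    only, before the dimension, the objective and \<open>\<gamma>\<close> are known.\<close>
  define C where "C \<kappa> \<omega> = (SOME C. modes_constant \<kappa> \<omega> C)" for \<kappa> \<omega>
  have C: "modes_constant \<kappa> \<omega> (C \<kappa> \<omega>)" if "4 \<le> \<kappa>" "0 < \<omega>" for \<kappa> \<omega>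
    unfolding C_def by (rule someI_ex) (rule modes_constant_exists[OF that])
  \<comment> \<open>Here \<open>1327104 = 1152\<^sup>2\<close>, which explains the witness
    \<open>1327104 * \<gamma>\<close> for \<open>\<sigma>\<close>.\<close>
  have rate: "1152 * sqrt (\<gamma> * \<kappa>) = sqrt (1327104 * \<gamma> * \<kappa>)" for \<gamma> \<kappa> :: real
  proof -
    have "sqrt (1327104 * \<gamma> * \<kappa>) = sqrt (1152\<^sup>2) * sqrt (\<gamma> * \<kappa>)"
      by (simp only: real_sqrt_mult[symmetric]) (simp add: mult.assoc)
    thus ?thesis by simp
  qed
  show ?thesis
  proof (rule exI[of _ "\<lambda>\<gamma>. 1327104 * \<gamma>"], rule exI[of _ C], intro conjI allI impI, goal_cases)
    case (1 \<gamma>)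
    thus ?case by simp
  next
    case (2 E d f L m xs v lam L0 \<gamma> \<gamma>L \<delta> \<omega>)
    then interpret nag_problem E f L m xs v lam d L0 \<gamma> \<gamma>L
      by unfold_locales auto
    have \<omega>: "0 < \<omega>" using 2 by blast
    obtain \<epsilon> where "0 < \<epsilon>" and \<epsilon>: "\<And>x0 t. x0 \<in> E \<Longrightarrow> (norm (x0 - xs))\<^sup>2 \<le> \<omega> * ((x0 - xs) \<bullet> v 1)\<^sup>2 \<Longrightarrow>
        norm (x0 - xs) \<le> \<epsilon> \<Longrightarrow> nag_defined E f L0 \<gamma> \<gamma>L x0 t \<Longrightarrow>
        norm (nag_x E f L0 \<gamma> \<gamma>L x0 (Suc t) - xs)
          \<le> C (L0 / m) \<omega> * (1 - 1 / sqrt (1327104 * \<gamma> * (L0 / m))) ^ t * norm (x0 - xs)"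
      using local_rate[OF \<omega> C[OF kappa_bar_ge_4 \<omega>]] unfolding kappa_bar_def rate by blast
    thus ?case by (intro exI[of _ \<epsilon>]) blast
  qed
qed

end
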